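(* Let $(X,\mathcal{O}_X)$ be a locally ringed space with paracompact underlying topological space and let $\mathcal{U}=\{U_i\}$ be a locally finite open cover of $X$. Let $\mathcal{E}=(E_i^\bullet,a)$ be a generalized twisted complex and let $(\mathcal{S}^\bullet(\mathcal{E}),\delta_a)$ be the associated complex of sheaves. Then for each $j$, $(\mathcal{S}^\bullet(\mathcal{E}),\delta_a)|_{U_j}$ is a splitting of the (homotopy) idempotent $a^{1,0}_{jj}:(E_j^\bullet,a_j^{0,1})\to(E_j^\bullet,a_j^{0,1})$; i.e. there are two chain morphisms $$f:(\mathcal{S}^\bullet(\mathcal{E}),\delta_a)|_{U_j}\to(E_j^\bullet,a_j^{0,1}),\qquad g:(E_j^\bullet,a_j^{0,1})\to(\mathcal{S}^\bullet(\mathcal{E}),\delta_a)|_{U_j}$$ such that $f\circ g=a^{1,0}_{jj}$ and $g\circ f=\mathrm{id}_{\mathcal{S}^\bullet(\mathcal{E})|_{U_j}}$ up to chain homotopy.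
   Context: Write $U_{i_0\ldots i_n}=U_{i_0}\cap\cdots\cap U_{i_n}$ (indices are neither ordered nor required to be distinct). **Bigraded maps.** Given graded sheaves of $\mathcal{O}_X$-modules $E_i^\bullet,F_i^\bullet$ on each $U_i$, $C^p(\mathcal{U},\mathrm{Hom}^q(E,F))$ is the set of families $u^{p,q}=(u^{p,q}_{i_0\ldots i_p})$ where $u^{p,q}_{i_0\ldots i_p}$ is a degree $q$ map of graded $\mathcal{O}_X$-modules $E^\bullet_{i_p}\to F^\bullet_{i_0}$ over $U_{i_0\ldots i_p}$ (zero if the intersection is empty). Composition: $(u\cdot v)^{p+r,q+s}_{i_0\ldots i_{p+r}}=(-1)^{qr}u^{p,q}_{i_0\ldots i_p}v^{r,s}_{i_p\ldots i_{p+r}}$. Differential of bidegree $(1,0)$: $(\delta u)^{p+1,q}_{i_0\ldots i_{p+1}}=\sum_{k=1}^{p}(-1)^k u^{p,q}_{i_0\ldots\widehat{i_k}\ldots i_{p+1}}|_{U_{i_0\ldots i_{p+1}}}$. **Generalized twisted complexes.** A generalized twisted complex $\mathcal{E}=(E_i^\bullet,a)$ consists of graded sheaves $E_i^\bullet$ of $\mathcal{O}_X$-modules on each $U_i$ and $a=\sum_{k\ge 0}a^{k,1-k}$, $a^{k,1-k}\in C^k(\mathcal{U},\mathrm{Hom}^{1-k}(E,E))$, with $\delta a+a\cdot a=0$. (No condition that $a^{1,0}_{ii}$ be homotopic to the identity is imposed.) The Maurer–Cartan equation makes $(E_j^\bullet,a_j^{0,1})$ a complex and $a^{1,0}_{jj}$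 a chain endomorphism of it which is idempotent up to chain homotopy. **Associated complex of sheaves.** For $V\subseteq X$ open, $C^p(\mathcal{U},E^q;V)$ is the set of families $c=(c^{p,q}_{i_0\ldots i_p})$ with $c^{p,q}_{i_0\ldots i_p}\in E^q_{i_0}(U_{i_0\ldots i_p}\cap V)$ (zero if empty). Set $(\delta c)^{p+1,q}_{i_0\ldots i_{p+1}}=\sum_{k=1}^{p+1}(-1)^k c^{p,q}_{i_0\ldots\widehat{i_k}\ldots i_{p+1}}$ (restricted) and, for $u$ a bigraded map, $(u\cdot c)^{p+r,q+s}_{i_0\ldots i_{p+r}}=(-1)^{qr}u^{p,q}_{i_0\ldots i_p}(c^{r,s}_{i_p\ldots i_{p+r}})$. $\mathcal{S}(\mathcal{E})$ has $\mathcal{S}^n(\mathcal{E})(V)=\prod_{p+q=n}C^p(\mathcal{U},E^q;V)$ with differential $\delta_a c=\delta c+a\cdot c$. *)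

theory Defs
  imports "HOL-Analysis.Abstract_Topology" "HOL-Algebra.Ideal" "HOL-Algebra.Module"
begin

section \<open>Sheaves of rings and of modules\<close>

record ('a, 's, 'b) presheaf =
  sections :: "'a set \<Rightarrow> ('s, 'b) ring_scheme"
  restr :: "'a set \<Rightarrow> 'a set \<Rightarrow> 's \<Rightarrow> 's"

text \<open>In \<open>restr F U V\<close> the first set is the larger one.  Only the values of
  \<open>sections\<close> and \<open>restr\<close> on open sets of the space under consideration matter, so the
  restriction of a sheaf on \<open>X\<close> to an open set \<open>U\<close> is the same record, regarded over
  \<open>subtopology X U\<close>.\<close>

type_synonym ('a, 'r) ring_presheaf = "('a, 'r, unit) presheaf"
type_synonym ('a, 'r, 'm) module_presheaf = "('a, 'm, ('r, 'm, unit) module_ext) presheaf"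

locale sheaf =
  fixes X :: "'a topology" and F :: "('a, 's, 'b) presheaf"
  assumes restr_closed:
      "\<lbrakk>openin X U; openin X V; V \<subseteq> U; s \<in> carrier (sections F U)\<rbrakk>
        \<Longrightarrow> restr F U V s \<in> carrier (sections F V)"
    and restr_id:
      "\<lbrakk>openin X U; s \<in> carrier (sections F U)\<rbrakk> \<Longrightarrow> restr F U U s = s"
    and restr_comp:
      "\<lbrakk>openin X U; openin X V; openin X W; W \<subseteq> V; V \<subseteq> U; s \<in> carrier (sections F U)\<rbrakk>
        \<Longrightarrow> restr F V W (restr F U V s) = restr F U W s"
    and locality:
      "\<lbrakk>\<forall>V\<in>\<V>. openin X V; s \<in> carrier (sections F (\<Union>\<V>)); t \<in> carrier (sections F (\<Union>\<V>));
        \<forall>V\<in>\<V>. restr F (\<Union>\<V>) V s = restr F (\<Union>\<V>) V t\<rbrakk> \<Longrightarrow> s = t"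
    and gluing:
      "\<lbrakk>\<forall>V\<in>\<V>. openin X V; \<forall>V\<in>\<V>. \<sigma> V \<in> carrier (sections F V);
        \<forall>V\<in>\<V>. \<forall>W\<in>\<V>. restr F V (V \<inter> W) (\<sigma> V) = restr F W (V \<inter> W) (\<sigma> W)\<rbrakk>
        \<Longrightarrow> \<exists>s\<in>carrier (sections F (\<Union>\<V>)). \<forall>V\<in>\<V>. restr F (\<Union>\<V>) V s = \<sigma> V"

text \<open>The empty family \<open>\<V>\<close> is allowed: a sheaf has exactly one section over \<open>{}\<close>.\<close>

locale sheaf_of_rings = sheaf X \<O>
  for X :: "'a topology" and \<O> :: "('a, 'r) ring_presheaf" +
  assumes sections_cring: "openin X U \<Longrightarrow> cring (sections \<O> U)"
    and restr_ring_hom: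
      "\<lbrakk>openin X U; openin X V; V \<subseteq> U\<rbrakk>
        \<Longrightarrow> restr \<O> U V \<in> ring_hom (sections \<O> U) (sections \<O> V)"

locale sheaf_of_modules = sheaf X E
  for X :: "'a topology" and \<O> :: "('a, 'r) ring_presheaf" and E :: "('a, 'r, 'm) module_presheaf" +
  assumes sections_module: "openin X U \<Longrightarrow> module (sections \<O> U) (sections E U)"
    and restr_add:
      "\<lbrakk>openin X U; openin X V; V \<subseteq> U; s \<in> carrier (sections E U); t \<in> carrier (sections E U)\<rbrakk>
        \<Longrightarrow> restr E U V (s \<oplus>\<^bsub>sections E U\<^esub> t)
            = restr E U V s \<oplus>\<^bsub>sections E V\<^esub> restr E U V t"
    and restr_smult:
      "\<lbrakk>openin X U; openin X V; V \<subseteq> U; r \<in> carrier (sections \<O> U); s \<in> carrier (sections E U)\<rbrakk>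
        \<Longrightarrow> restr E U V (r \<odot>\<^bsub>sections E U\<^esub> s)
            = restr \<O> U V r \<odot>\<^bsub>sections E V\<^esub> restr E U V s"

definition sheaf_hom ::
  "'a topology \<Rightarrow> ('a, 'r) ring_presheaf \<Rightarrow> ('a, 'r, 'm) module_presheaf
    \<Rightarrow> ('a, 'r, 'n) module_presheaf \<Rightarrow> ('a set \<Rightarrow> 'm \<Rightarrow> 'n) \<Rightarrow> bool" where
  "sheaf_hom X \<O> E F \<phi> \<longleftrightarrow>
    (\<forall>V. openin X V \<longrightarrow>
      (\<forall>s\<in>carrier (sections E V). \<phi> V s \<in> carrier (sections F V)) \<and>
      (\<forall>s\<in>carrier (sections E V). \<forall>t\<in>carrier (sections E V).
        \<phi> V (s \<oplus>\<^bsub>sections E V\<^esub> t) = \<phi> V s \<oplus>\<^bsub>sections F V\<^esub> \<phi> V t) \<and>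
      (\<forall>r\<in>carrier (sections \<O> V). \<forall>s\<in>carrier (sections E V).
        \<phi> V (r \<odot>\<^bsub>sections E V\<^esub> s) = r \<odot>\<^bsub>sections F V\<^esub> \<phi> V s)) \<and>
    (\<forall>V W. openin X V \<longrightarrow> openin X W \<longrightarrow> W \<subseteq> V \<longrightarrow>
      (\<forall>s\<in>carrier (sections E V). restr F V W (\<phi> V s) = \<phi> W (restr E V W s)))"


section \<open>Locally ringed spaces\<close>

definition germ_rel :: "'a topology \<Rightarrow> ('a, 'r) ring_presheaf \<Rightarrow> 'a \<Rightarrow> (('a set \<times> 'r) \<times> ('a set \<times> 'r)) set"
  where
  "germ_rel X F x =
    {((U, s), (V, t)). openin X U \<and> x \<in> U \<and> s \<in> carrier (sections F U) \<and>
       openin X V \<and> x \<in> V \<and> t \<in> carrier (sections F V) \<and>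
       (\<exists>W. openin X W \<and> x \<in> W \<and> W \<subseteq> U \<inter> V \<and> restr F U W s = restr F V W t)}"

definition germ :: "'a topology \<Rightarrow> ('a, 'r) ring_presheaf \<Rightarrow> 'a \<Rightarrow> 'a set \<Rightarrow> 'r \<Rightarrow> ('a set \<times> 'r) set"
  where "germ X F x U s = germ_rel X F x `` {(U, s)}"

text \<open>As in a quotient by an equivalence relation, the unions below run over representatives and are
  unions of identical classes.\<close>

definition stalk :: "'a topology \<Rightarrow> ('a, 'r) ring_presheaf \<Rightarrow> 'a \<Rightarrow> ('a set \<times> 'r) set ring" where
  "stalk X F x =
    \<lparr>carrier = {germ X F x U s | U s. openin X U \<and> x \<in> U \<and> s \<in> carrier (sections F U)},
     monoid.mult = (\<lambda>A B. \<Union>(U, s)\<in>A. \<Union>(V, t)\<in>B. germ X F x (U \<inter> V)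
       (restr F U (U \<inter> V) s \<otimes>\<^bsub>sections F (U \<inter> V)\<^esub> restr F V (U \<inter> V) t)),
     one = germ X F x (topspace X) \<one>\<^bsub>sections F (topspace X)\<^esub>,
     zero = germ X F x (topspace X) \<zero>\<^bsub>sections F (topspace X)\<^esub>,
     add = (\<lambda>A B. \<Union>(U, s)\<in>A. \<Union>(V, t)\<in>B. germ X F x (U \<inter> V)
       (restr F U (U \<inter> V) s \<oplus>\<^bsub>sections F (U \<inter> V)\<^esub> restr F V (U \<inter> V) t))\<rparr>"

definition local_ring :: "('r, 'b) ring_scheme \<Rightarrow> bool" where
  "local_ring R \<longleftrightarrow> cring R \<and> (\<exists>!M. maximalideal M R)"

locale locally_ringed_space = sheaf_of_rings X \<O>
  for X :: "'a topology" and \<O> :: "('a, 'r) ring_presheaf" +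
  assumes stalks_local: "x \<in> topspace X \<Longrightarrow> local_ring (stalk X \<O> x)"


section \<open>Paracompactness and locally finite covers\<close>

text \<open>No separation axiom is included.\<close>

definition paracompact_space :: "'a topology \<Rightarrow> bool" where
  "paracompact_space X \<longleftrightarrow>
    (\<forall>\<C>. (\<forall>U\<in>\<C>. openin X U) \<and> \<Union>\<C> = topspace X \<longrightarrow>
      (\<exists>\<D>. (\<forall>V\<in>\<D>. openin X V \<and> (\<exists>U\<in>\<C>. V \<subseteq> U)) \<and> \<Union>\<D> = topspace X \<and> locally_finite_in X \<D>))"

definition locally_finite_open_cover :: "'a topology \<Rightarrow> 'i set \<Rightarrow> ('i \<Rightarrow> 'a set) \<Rightarrow> bool" where
  "locally_finite_open_cover X I U \<longleftrightarrow>
    (\<forall>i\<in>I. openin X (U i)) \<and> (\<Union>i\<in>I. U i) = topspace X \<and>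
    (\<forall>x\<in>topspace X. \<exists>N. openin X N \<and> x \<in> N \<and> finite {i\<in>I. U i \<inter> N \<noteq> {}})"


section \<open>Complexes of sheaves of modules\<close>

text \<open>A complex is given by a \<open>\<int>\<close>-graded sheaf and a family of differentials \<open>d n\<close> from degree
  \<open>n\<close> to degree \<open>n + 1\<close>.\<close>

type_synonym ('a, 'r, 'm) graded_sheaf = "int \<Rightarrow> ('a, 'r, 'm) module_presheaf"
type_synonym ('a, 'm, 'n) graded_map = "int \<Rightarrow> 'a set \<Rightarrow> 'm \<Rightarrow> 'n"

definition chain_map ::
  "'a topology \<Rightarrow> ('a, 'r) ring_presheaf
    \<Rightarrow> ('a, 'r, 'm) graded_sheaf \<Rightarrow> ('a, 'm, 'm) graded_map
    \<Rightarrow> ('a, 'r, 'n) graded_sheaf \<Rightarrow> ('a, 'n, 'n) graded_map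
    \<Rightarrow> ('a, 'm, 'n) graded_map \<Rightarrow> bool" where
  "chain_map X \<O> C dC D dD f \<longleftrightarrow>
    (\<forall>n. sheaf_hom X \<O> (C n) (D n) (f n)) \<and>
    (\<forall>n V. openin X V \<longrightarrow> (\<forall>s\<in>carrier (sections (C n) V).
      f (n + 1) V (dC n V s) = dD n V (f n V s)))"

definition chain_homotopic ::
  "'a topology \<Rightarrow> ('a, 'r) ring_presheaf
    \<Rightarrow> ('a, 'r, 'm) graded_sheaf \<Rightarrow> ('a, 'm, 'm) graded_map
    \<Rightarrow> ('a, 'r, 'n) graded_sheaf \<Rightarrow> ('a, 'n, 'n) graded_map
    \<Rightarrow> ('a, 'm, 'n) graded_map \<Rightarrow> ('a, 'm, 'n) graded_map \<Rightarrow> bool" where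
  "chain_homotopic X \<O> C dC D dD f g \<longleftrightarrow>
    (\<exists>h. (\<forall>n. sheaf_hom X \<O> (C n) (D (n - 1)) (h n)) \<and>
      (\<forall>n V. openin X V \<longrightarrow> (\<forall>s\<in>carrier (sections (C n) V).
        f n V s \<ominus>\<^bsub>sections (D n) V\<^esub> g n V s
          = dD (n - 1) V (h n V s) \<oplus>\<^bsub>sections (D n) V\<^esub> h (n + 1) V (dC n V s))))"


section \<open>Generalized twisted complexes\<close>

text \<open>An index tuple \<open>i\<^sub>0\<dots>i\<^sub>p\<close> is a list of length \<open>p + 1\<close>.\<close>

definition inters :: "('i \<Rightarrow> 'a set) \<Rightarrow> 'i list \<Rightarrow> 'a set" where
  "inters U xs = (\<Inter>i\<in>set xs. U i)"

definition omit :: "nat \<Rightarrow> 'i list \<Rightarrow> 'i list" where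
  "omit k xs = take k xs @ drop (Suc k) xs"

definition signed :: "('m, 'b) ring_scheme \<Rightarrow> int \<Rightarrow> 'm \<Rightarrow> 'm" where
  "signed M k x = (if even k then x else \<ominus>\<^bsub>M\<^esub> x)"

text \<open>A family of bigraded maps \<open>u\<close> is encoded so that \<open>u xs m V\<close> is the value over \<open>V\<close> of the
  component indexed by \<open>xs\<close>, in source degree \<open>m\<close>.  The simplicial degree of a component is read off
  from \<open>xs\<close>, so one such function also encodes a sum of families with one summand for each
  simplicial degree, such as \<open>a = \<Sum>k. a\<^sup>k\<^sup>,\<^sup>1\<^sup>-\<^sup>k\<close>.\<close>

type_synonym ('i, 'a, 'm, 'n) bigraded_map = "'i list \<Rightarrow> ('a, 'm, 'n) graded_map"

definition hom_cochains ::
  "'a topology \<Rightarrow> ('a, 'r) ring_presheaf \<Rightarrow> 'i set \<Rightarrow> ('i \<Rightarrow> 'a set) \<Rightarrow> nat \<Rightarrow> int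
    \<Rightarrow> ('i \<Rightarrow> ('a, 'r, 'm) graded_sheaf) \<Rightarrow> ('i \<Rightarrow> ('a, 'r, 'n) graded_sheaf)
    \<Rightarrow> ('i, 'a, 'm, 'n) bigraded_map set" where
  "hom_cochains X \<O> I U p q E F =
    {u. \<forall>xs m. set xs \<subseteq> I \<and> length xs = Suc p \<longrightarrow>
      sheaf_hom (subtopology X (inters U xs)) \<O> (E (last xs) m) (F (hd xs) (m + q)) (u xs m)}"

text \<open>The component of \<open>u\<^sup>p\<^sup>,\<^sup>q \<cdot> v\<^sup>r\<^sup>,\<^sup>s\<close> indexed by a tuple \<open>xs\<close> of length \<open>p + r + 1\<close>; \<open>F\<close> is the target
  of \<open>u\<close>.\<close>

definition hom_comp ::
  "('i \<Rightarrow> ('a, 'r, 'l) graded_sheaf) \<Rightarrow> nat \<Rightarrow> int \<Rightarrow> nat \<Rightarrow> int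
    \<Rightarrow> ('i, 'a, 'n, 'l) bigraded_map \<Rightarrow> ('i, 'a, 'm, 'n) bigraded_map
    \<Rightarrow> ('i, 'a, 'm, 'l) bigraded_map" where
  "hom_comp F p q r s u v xs m V e =
    signed (sections (F (hd xs) (m + s + q)) V) (q * int r)
      (u (take (Suc p) xs) (m + s) V (v (drop p xs) m V e))"

text \<open>The component of \<open>\<delta> u\<close>, for \<open>u\<close> of internal degree \<open>q\<close>, indexed by a tuple of
  length \<open>p + 2\<close>: the sum omits neither the first nor the last index.\<close>

definition hom_delta ::
  "('i \<Rightarrow> ('a, 'r, 'n) graded_sheaf) \<Rightarrow> int
    \<Rightarrow> ('i, 'a, 'm, 'n) bigraded_map \<Rightarrow> ('i, 'a, 'm, 'n) bigraded_map" where
  "hom_delta F q u xs m V e =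
    (\<Oplus>\<^bsub>sections (F (hd xs) (m + q)) V\<^esub> k\<in>{1..length xs - 2}.
      signed (sections (F (hd xs) (m + q)) V) (int k) (u (omit k xs) m V e))"

text \<open>The Maurer--Cartan equation is stated in each simplicial degree \<open>n\<close>, where it takes values
  in maps of degree \<open>2 - n\<close>.\<close>

definition maurer_cartan ::
  "'a topology \<Rightarrow> 'i set \<Rightarrow> ('i \<Rightarrow> 'a set) \<Rightarrow> ('i \<Rightarrow> ('a, 'r, 'm) graded_sheaf)
    \<Rightarrow> ('i, 'a, 'm, 'm) bigraded_map \<Rightarrow> bool" where
  "maurer_cartan X I U E a \<longleftrightarrow>
    (\<forall>n xs m V e. set xs \<subseteq> I \<and> length xs = Suc n \<and> openin X V \<and> V \<subseteq> inters U xs \<and>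
        e \<in> carrier (sections (E (last xs) m) V) \<longrightarrow>
      hom_delta E (2 - int n) a xs m V e
        \<oplus>\<^bsub>sections (E (hd xs) (m + (2 - int n))) V\<^esub>
      (\<Oplus>\<^bsub>sections (E (hd xs) (m + (2 - int n))) V\<^esub> k\<in>{..n}.
        hom_comp E k (1 - int k) (n - k) (1 - int (n - k)) a a xs m V e)
      = \<zero>\<^bsub>sections (E (hd xs) (m + (2 - int n))) V\<^esub>)"

definition generalized_twisted_complex ::
  "'a topology \<Rightarrow> ('a, 'r) ring_presheaf \<Rightarrow> 'i set \<Rightarrow> ('i \<Rightarrow> 'a set)
    \<Rightarrow> ('i \<Rightarrow> ('a, 'r, 'm) graded_sheaf) \<Rightarrow> ('i, 'a, 'm, 'm) bigraded_map \<Rightarrow> bool" where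
  "generalized_twisted_complex X \<O> I U E a \<longleftrightarrow>
    (\<forall>i\<in>I. \<forall>q. sheaf_of_modules (subtopology X (U i)) \<O> (E i q)) \<and>
    (\<forall>k. a \<in> hom_cochains X \<O> I U k (1 - int k) E E) \<and>
    maurer_cartan X I U E a"


section \<open>The associated complex of sheaves\<close>

definition tuples :: "'i set \<Rightarrow> 'i list set" where
  "tuples I = {xs. xs \<noteq> [] \<and> set xs \<subseteq> I}"

definition sdeg :: "'i list \<Rightarrow> nat" where
  "sdeg xs = length xs - 1"

text \<open>Here \<open>n\<close> is the total degree of the cochain.\<close>

definition comp_module ::
  "('i \<Rightarrow> 'a set) \<Rightarrow> ('i \<Rightarrow> ('a, 'r, 'm) graded_sheaf) \<Rightarrow> int \<Rightarrow> 'a set \<Rightarrow> 'i list \<Rightarrow> ('r, 'm) module"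
  where
  "comp_module U E n V xs = sections (E (hd xs) (n - int (sdeg xs))) (inters U xs \<inter> V)"

text \<open>The products over \<open>p + q = n\<close> and over the tuples of length \<open>p + 1\<close> are combined into one
  extensional product over all nonempty tuples.  The ring operations \<open>\<otimes>\<close> and \<open>\<one>\<close> of a module
  record are not used.\<close>

definition assoc_sheaf ::
  "('a, 'r) ring_presheaf \<Rightarrow> 'i set \<Rightarrow> ('i \<Rightarrow> 'a set) \<Rightarrow> ('i \<Rightarrow> ('a, 'r, 'm) graded_sheaf)
    \<Rightarrow> ('a, 'r, 'i list \<Rightarrow> 'm) graded_sheaf" where
  "assoc_sheaf \<O> I U E n =
    \<lparr>sections = (\<lambda>V.
       \<lparr>carrier = (\<Pi>\<^sub>E xs\<in>tuples I. carrier (comp_module U E n V xs)),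
        monoid.mult = undefined,
        one = undefined,
        zero = (\<lambda>xs\<in>tuples I. \<zero>\<^bsub>comp_module U E n V xs\<^esub>),
        add = (\<lambda>b c. \<lambda>xs\<in>tuples I. b xs \<oplus>\<^bsub>comp_module U E n V xs\<^esub> c xs),
        smult = (\<lambda>r c. \<lambda>xs\<in>tuples I.
          restr \<O> V (inters U xs \<inter> V) r \<odot>\<^bsub>comp_module U E n V xs\<^esub> c xs)\<rparr>),
     restr = (\<lambda>V W c. \<lambda>xs\<in>tuples I.
       restr (E (hd xs) (n - int (sdeg xs))) (inters U xs \<inter> V) (inters U xs \<inter> W) (c xs))\<rparr>"

text \<open>The component of \<open>\<delta> c\<close> indexed by \<open>xs\<close>, for \<open>c\<close> of total degree \<open>n\<close>: unlike in
  \<open>hom_delta\<close>, the last index may be omitted.\<close>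

definition cochain_delta ::
  "('i \<Rightarrow> 'a set) \<Rightarrow> ('i \<Rightarrow> ('a, 'r, 'm) graded_sheaf) \<Rightarrow> int \<Rightarrow> 'a set
    \<Rightarrow> ('i list \<Rightarrow> 'm) \<Rightarrow> 'i list \<Rightarrow> 'm" where
  "cochain_delta U E n V c xs =
    (\<Oplus>\<^bsub>comp_module U E (n + 1) V xs\<^esub> k\<in>{1..sdeg xs}.
      signed (comp_module U E (n + 1) V xs) (int k)
        (restr (E (hd xs) (n + 1 - int (sdeg xs)))
          (inters U (omit k xs) \<inter> V) (inters U xs \<inter> V) (c (omit k xs))))"

text \<open>The component of \<open>u\<^sup>p\<^sup>,\<^sup>q \<cdot> c\<^sup>r\<^sup>,\<^sup>s\<close> indexed by a tuple \<open>xs\<close> of length \<open>p + r + 1\<close>.\<close>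

definition cochain_act ::
  "('i \<Rightarrow> 'a set) \<Rightarrow> ('i \<Rightarrow> ('a, 'r, 'm) graded_sheaf) \<Rightarrow> nat \<Rightarrow> int \<Rightarrow> nat \<Rightarrow> int \<Rightarrow> 'a set
    \<Rightarrow> ('i, 'a, 'm, 'm) bigraded_map \<Rightarrow> ('i list \<Rightarrow> 'm) \<Rightarrow> 'i list \<Rightarrow> 'm" where
  "cochain_act U E p q r s V u c xs =
    signed (sections (E (hd xs) (s + q)) (inters U xs \<inter> V)) (q * int r)
      (u (take (Suc p) xs) s (inters U xs \<inter> V)
        (restr (E (xs ! p) s) (inters U (drop p xs) \<inter> V) (inters U xs \<inter> V) (c (drop p xs))))"

definition assoc_diff ::
  "'i set \<Rightarrow> ('i \<Rightarrow> 'a set) \<Rightarrow> ('i \<Rightarrow> ('a, 'r, 'm) graded_sheaf) \<Rightarrow> ('i, 'a, 'm, 'm) bigraded_map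
    \<Rightarrow> ('a, 'i list \<Rightarrow> 'm, 'i list \<Rightarrow> 'm) graded_map" where
  "assoc_diff I U E a n V c = (\<lambda>xs\<in>tuples I.
    cochain_delta U E n V c xs
      \<oplus>\<^bsub>comp_module U E (n + 1) V xs\<^esub>
    (\<Oplus>\<^bsub>comp_module U E (n + 1) V xs\<^esub> k\<in>{..sdeg xs}.
      cochain_act U E k (1 - int k) (sdeg xs - k) (n - int (sdeg xs - k)) V a c xs))"

end

theory Submission
  imports Defs
begin

text \<open>On \<open>U j\<close> every intersection \<open>U\<^bsub>i0...ip\<^esub> \<inter> V\<close> coincides with
  \<open>U\<^bsub>i0...ip j\<^esub> \<inter> V\<close>, so an index \<open>j\<close> can be appended to any tuple.  Take
  \<open>f c = c\<^bsub>j\<^esub>\<close> and \<open>(g e)\<^bsub>i0...ip\<^esub> = (-1)\<^sup>p a\<^bsub>i0...ip j\<^esub> e\<close>.  Then \<open>f \<circ> g = a\<^bsub>jj\<^esub>\<close> on the nose,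
  and \<open>g\<close> commutes with the differentials by the Maurer--Cartan equation at \<open>i0...ip j\<close>.  The
  contraction \<open>(h c)\<^bsub>i0...ip\<^esub> = (-1)\<^sup>p c\<^bsub>i0...ip j\<^esub>\<close> is a homotopy from \<open>g \<circ> f\<close> to the identity: in
  \<open>\<delta>\<^sub>a h + h \<delta>\<^sub>a\<close> everything cancels except the two terms of \<open>\<delta>\<^sub>a c\<close> at \<open>i0...ip j\<close> in which the
  appended \<open>j\<close> is omitted, giving \<open>- c\<^bsub>i0...ip\<^esub>\<close>, or is alone left to \<open>c\<close>, giving \<open>g (c\<^bsub>j\<^esub>)\<close>.\<close>

section \<open>Signs\<close>

lemma signed_closed: "\<lbrakk>abelian_group M; x \<in> carrier M\<rbrakk> \<Longrightarrow> signed M k x \<in> carrier M"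
  by (simp add: signed_def abelian_group.a_inv_closed)

lemma signed_signed:
  "\<lbrakk>abelian_group M; x \<in> carrier M\<rbrakk> \<Longrightarrow> signed M k (signed M l x) = signed M (k + l) x"
  by (auto simp: signed_def abelian_group.minus_minus)

text \<open>Only the parity of an exponent matters. Each sign comparison below first collects nested
  signs with \<open>signed_signed\<close> and is then a parity check on integers.\<close>

lemma signed_cong: "even k = even l \<Longrightarrow> signed M k x = signed M l x"
  by (simp add: signed_def)

lemma signed_add:
  "\<lbrakk>abelian_group M; x \<in> carrier M; y \<in> carrier M\<rbrakk>
    \<Longrightarrow> signed M k (x \<oplus>\<^bsub>M\<^esub> y) = signed M k x \<oplus>\<^bsub>M\<^esub> signed M k y"
  by (simp add: signed_def abelian_group.minus_add)

lemma signed_finsum: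
  assumes M: "abelian_group M" and "finite A" "\<And>i. i \<in> A \<Longrightarrow> f i \<in> carrier M"
  shows "signed M k (finsum M f A) = finsum M (\<lambda>i. signed M k (f i)) A"
proof -
  interpret abelian_group M by fact
  show ?thesis
    using assms(2,3)
  proof (induction A rule: finite_induct)
    case empty
    then show ?case by (simp add: signed_def)
  next
    case (insert i A)
    then show ?case
      by (simp add: signed_add[OF M] signed_closed[OF M] Pi_def)
  qed
qed

lemma signed_smult:
  assumes "module R M" "r \<in> carrier R" "x \<in> carrier M"
  shows "signed M k (r \<odot>\<^bsub>M\<^esub> x) = r \<odot>\<^bsub>M\<^esub> signed M k x"
  using assms by (simp add: signed_def module.smult_r_minus)

text \<open>Both \<open>sheaf_hom\<close> and \<open>sheaf_of_modules\<close> ask only for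
  additivity; zero is preserved because one \<open>f 0\<close> can be cancelled from
  \<open>f 0 + f 0 = f 0\<close>.\<close>

lemma additive_zero:
  assumes "abelian_group M" "abelian_group N"
    and "\<And>x. x \<in> carrier M \<Longrightarrow> f x \<in> carrier N"
    and "\<And>x y. \<lbrakk>x \<in> carrier M; y \<in> carrier M\<rbrakk> \<Longrightarrow> f (x \<oplus>\<^bsub>M\<^esub> y) = f x \<oplus>\<^bsub>N\<^esub> f y"
  shows "f \<zero>\<^bsub>M\<^esub> = \<zero>\<^bsub>N\<^esub>"
proof -
  interpret M: abelian_group M by fact
  interpret N: abelian_group N by fact
  have "f \<zero>\<^bsub>M\<^esub> \<oplus>\<^bsub>N\<^esub> f \<zero>\<^bsub>M\<^esub> = f \<zero>\<^bsub>M\<^esub>"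
    using assms(4)[of "\<zero>\<^bsub>M\<^esub>" "\<zero>\<^bsub>M\<^esub>"] by simp
  then show ?thesis
    using assms(3)[of "\<zero>\<^bsub>M\<^esub>"] by simp
qed

text \<open>Inverses are unique, so the image of the inverse of \<open>x\<close> is the inverse of
  \<open>f x\<close>. This pulls signs out of restrictions and out of the components of
  \<open>a\<close>.\<close>

lemma additive_signed:
  assumes M: "abelian_group M" and N: "abelian_group N"
    and cl: "\<And>x. x \<in> carrier M \<Longrightarrow> f x \<in> carrier N"
    and add: "\<And>x y. \<lbrakk>x \<in> carrier M; y \<in> carrier M\<rbrakk> \<Longrightarrow> f (x \<oplus>\<^bsub>M\<^esub> y) = f x \<oplus>\<^bsub>N\<^esub> f y"
    and x: "x \<in> carrier M"
  shows "f (signed M k x) = signed N k (f x)"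
proof -
  interpret M: abelian_group M by fact
  interpret N: abelian_group N by fact
  have "f (\<ominus>\<^bsub>M\<^esub> x) \<oplus>\<^bsub>N\<^esub> f x = \<zero>\<^bsub>N\<^esub>"
    using add[of "\<ominus>\<^bsub>M\<^esub> x" x] additive_zero[of M N f, OF M N cl add] x by (simp add: M.l_neg)
  then have "\<ominus>\<^bsub>N\<^esub> (f x) = f (\<ominus>\<^bsub>M\<^esub> x)"
    using x cl by (intro N.minus_equality) auto
  then show ?thesis by (simp add: signed_def)
qed

section \<open>Index tuples\<close>

lemma inters_simps:
  "inters U (xs @ ys) = inters U xs \<inter> inters U ys" "inters U [i] = U i"
  by (auto simp: inters_def)

lemma inters_mono: "set ys \<subseteq> set xs \<Longrightarrow> inters U xs \<subseteq> inters U ys"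
  by (auto simp: inters_def)

lemma tuples_take: "xs \<in> tuples I \<Longrightarrow> take (Suc k) xs \<in> tuples I"
  by (auto simp: tuples_def dest: in_set_takeD)

lemma tuples_drop: "\<lbrakk>xs \<in> tuples I; k \<le> sdeg xs\<rbrakk> \<Longrightarrow> drop k xs \<in> tuples I"
  using set_drop_subset[of k xs] by (cases xs) (auto simp: tuples_def sdeg_def)

lemma tuples_snoc: "\<lbrakk>xs \<in> tuples I; j \<in> I\<rbrakk> \<Longrightarrow> xs @ [j] \<in> tuples I"
  by (auto simp: tuples_def)

lemma tuples_omit: "\<lbrakk>xs \<in> tuples I; 1 \<le> k\<rbrakk> \<Longrightarrow> omit k xs \<in> tuples I"
  by (cases k; cases xs) (auto simp: tuples_def omit_def dest: in_set_dropD in_set_takeD)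

text \<open>A section at \<open>omit k xs\<close> still belongs to a sheaf attached to
  \<open>hd xs\<close>. This is why the sums in both differentials start at
  \<open>k = 1\<close>.\<close>

lemma hd_omit: "\<lbrakk>xs \<noteq> []; 1 \<le> k\<rbrakk> \<Longrightarrow> hd (omit k xs) = hd xs"
  by (cases k; cases xs) (auto simp: omit_def)

lemma sdeg_omit: "\<lbrakk>1 \<le> k; k \<le> sdeg xs\<rbrakk> \<Longrightarrow> sdeg (omit k xs) = sdeg xs - 1"
  by (auto simp: omit_def sdeg_def)

lemma set_omit: "set (omit k xs) \<subseteq> set xs"
  by (auto simp: omit_def dest: in_set_dropD in_set_takeD)

lemma sdeg_snoc: "xs \<noteq> [] \<Longrightarrow> sdeg (xs @ [j]) = Suc (sdeg xs)"
  by (cases xs) (auto simp: sdeg_def)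

lemma sdeg_take: "k \<le> sdeg xs \<Longrightarrow> sdeg (take (Suc k) xs) = k"
  by (auto simp: sdeg_def)

lemma sdeg_drop: "sdeg (drop k xs) = sdeg xs - k"
  by (auto simp: sdeg_def)

lemma hd_drop: "\<lbrakk>xs \<noteq> []; k \<le> sdeg xs\<rbrakk> \<Longrightarrow> hd (drop k xs) = xs ! k"
  by (cases xs) (auto simp: sdeg_def hd_drop_conv_nth)

lemma last_take: "\<lbrakk>xs \<noteq> []; k \<le> sdeg xs\<rbrakk> \<Longrightarrow> last (take (Suc k) xs) = xs ! k"
  by (cases xs) (auto simp: sdeg_def last_conv_nth min_def)

lemma hd_snoc: "xs \<noteq> [] \<Longrightarrow> hd (xs @ [j]) = hd xs"
  by simp

lemma omit_snoc:
  assumes "xs \<noteq> []" "k \<le> sdeg xs"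
  shows "omit k (xs @ [j]) = omit k xs @ [j]"
proof -
  have "k < length xs" using assms by (cases xs) (auto simp: sdeg_def)
  then show ?thesis by (simp add: omit_def)
qed

text \<open>Counting from 0, the appended \<open>j\<close> stands at position
  \<open>Suc (sdeg xs)\<close>. At \<open>xs @ [j]\<close> this position is omitted by
  \<open>cochain_delta\<close> but not by \<open>hom_delta\<close>.\<close>

lemma omit_last: "xs \<noteq> [] \<Longrightarrow> omit (Suc (sdeg xs)) (xs @ [j]) = xs"
  by (cases xs) (auto simp: omit_def sdeg_def)

lemma take_snoc: "\<lbrakk>xs \<noteq> []; k \<le> sdeg xs\<rbrakk> \<Longrightarrow> take (Suc k) (xs @ [j]) = take (Suc k) xs"
  by (cases xs) (auto simp: sdeg_def)

lemma drop_snoc: "\<lbrakk>xs \<noteq> []; k \<le> sdeg xs\<rbrakk> \<Longrightarrow> drop k (xs @ [j]) = drop k xs @ [j]"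
  by (cases xs rule: rev_cases) (auto simp: sdeg_def)

lemma nth_snoc: "\<lbrakk>xs \<noteq> []; k \<le> sdeg xs\<rbrakk> \<Longrightarrow> (xs @ [j]) ! k = xs ! k"
  by (cases xs rule: rev_cases) (auto simp: sdeg_def nth_append)

lemma length_tuple: "xs \<in> tuples I \<Longrightarrow> length xs = Suc (sdeg xs)"
  by (cases xs) (auto simp: tuples_def sdeg_def)

section \<open>The associated complex\<close>

lemma sheaf_homD:
  assumes "sheaf_hom X \<O> E F \<phi>" "openin X V"
  shows "s \<in> carrier (sections E V) \<Longrightarrow> \<phi> V s \<in> carrier (sections F V)"
    and "\<lbrakk>s \<in> carrier (sections E V); t \<in> carrier (sections E V)\<rbrakk>
      \<Longrightarrow> \<phi> V (s \<oplus>\<^bsub>sections E V\<^esub> t) = \<phi> V s \<oplus>\<^bsub>sections F V\<^esub> \<phi> V t"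
    and "\<lbrakk>r \<in> carrier (sections \<O> V); s \<in> carrier (sections E V)\<rbrakk>
      \<Longrightarrow> \<phi> V (r \<odot>\<^bsub>sections E V\<^esub> s) = r \<odot>\<^bsub>sections F V\<^esub> \<phi> V s"
    and "\<lbrakk>openin X W; W \<subseteq> V; s \<in> carrier (sections E V)\<rbrakk>
      \<Longrightarrow> restr F V W (\<phi> V s) = \<phi> W (restr E V W s)"
  using assms by (simp_all add: sheaf_hom_def)

locale twisted = sheaf_of_rings X \<O>
  for X :: "'a topology" and \<O> :: "('a, 'r) ring_presheaf" +
  fixes I :: "'i set"
    and U :: "'i \<Rightarrow> 'a set"
    and E :: "'i \<Rightarrow> ('a, 'r, 'm) graded_sheaf"
    and a :: "('i, 'a, 'm, 'm) bigraded_map"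
  assumes open_cover: "i \<in> I \<Longrightarrow> openin X (U i)"
    and twisted_complex: "generalized_twisted_complex X \<O> I U E a"
begin

lemma openin_U: "i \<in> I \<Longrightarrow> openin (subtopology X (U i)) V \<longleftrightarrow> openin X V \<and> V \<subseteq> U i"
  using open_cover openin_open_subtopology by blast

lemma openin_inters: "xs \<in> tuples I \<Longrightarrow> openin X (inters U xs)"
  unfolding inters_def tuples_def using open_cover by (intro openin_INT2) auto

lemma openin_inters_Int: "\<lbrakk>xs \<in> tuples I; openin X V\<rbrakk> \<Longrightarrow> openin X (inters U xs \<inter> V)"
  by (simp add: openin_inters openin_Int)

lemma inters_hd: "xs \<in> tuples I \<Longrightarrow> inters U xs \<subseteq> U (hd xs)"
  by (cases xs) (auto simp: inters_def tuples_def)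

lemma hd_in: "xs \<in> tuples I \<Longrightarrow> hd xs \<in> I"
  by (cases xs) (auto simp: tuples_def)

lemma nth_in: "\<lbrakk>xs \<in> tuples I; k \<le> sdeg xs\<rbrakk> \<Longrightarrow> xs ! k \<in> I"
  using length_tuple[of xs I] by (auto simp: tuples_def)

lemma E_sheaf: "i \<in> I \<Longrightarrow> sheaf_of_modules (subtopology X (U i)) \<O> (E i q)"
  using twisted_complex by (auto simp: generalized_twisted_complex_def)

section \<open>The modules of sections of the sheaves \<open>E i q\<close> and their restriction
  maps\<close>

lemma E_module:
  "\<lbrakk>i \<in> I; openin X V; V \<subseteq> U i\<rbrakk> \<Longrightarrow> module (sections \<O> V) (sections (E i q) V)"
  by (rule sheaf_of_modules.sections_module[OF E_sheaf]) (simp_all add: openin_U)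

lemma E_group: "\<lbrakk>i \<in> I; openin X V; V \<subseteq> U i\<rbrakk> \<Longrightarrow> abelian_group (sections (E i q) V)"
  using E_module module.axioms(2) by blast

lemma E_underlying_sheaf: "i \<in> I \<Longrightarrow> sheaf (subtopology X (U i)) (E i q)"
  by (rule sheaf_of_modules.axioms(1)[OF E_sheaf])

context
  fixes i V W
  assumes i: "i \<in> I" and V: "openin X V" and W: "openin X W" and VU: "V \<subseteq> U i" and WV: "W \<subseteq> V"
begin

lemma E_restr_closed:
  "s \<in> carrier (sections (E i q) V) \<Longrightarrow> restr (E i q) V W s \<in> carrier (sections (E i q) W)"
  by (rule sheaf.restr_closed[OF E_underlying_sheaf[OF i]]) (use i V W VU WV in \<open>auto simp: openin_U\<close>)

lemma E_restr_id: "s \<in> carrier (sections (E i q) V) \<Longrightarrow> restr (E i q) V V s = s"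
  by (rule sheaf.restr_id[OF E_underlying_sheaf[OF i]]) (use i V W VU WV in \<open>auto simp: openin_U\<close>)

lemma E_restr_comp:
  "\<lbrakk>openin X T; T \<subseteq> W; s \<in> carrier (sections (E i q) V)\<rbrakk>
    \<Longrightarrow> restr (E i q) W T (restr (E i q) V W s) = restr (E i q) V T s"
  by (rule sheaf.restr_comp[OF E_underlying_sheaf[OF i]]) (use i V W VU WV in \<open>auto simp: openin_U\<close>)

lemma E_restr_add:
  "\<lbrakk>s \<in> carrier (sections (E i q) V); t \<in> carrier (sections (E i q) V)\<rbrakk> \<Longrightarrow>
    restr (E i q) V W (s \<oplus>\<^bsub>sections (E i q) V\<^esub> t)
      = restr (E i q) V W s \<oplus>\<^bsub>sections (E i q) W\<^esub> restr (E i q) V W t"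
  by (rule sheaf_of_modules.restr_add[OF E_sheaf[OF i]]) (use i V W VU WV in \<open>auto simp: openin_U\<close>)

lemma E_restr_smult:
  "\<lbrakk>r \<in> carrier (sections \<O> V); s \<in> carrier (sections (E i q) V)\<rbrakk> \<Longrightarrow>
    restr (E i q) V W (r \<odot>\<^bsub>sections (E i q) V\<^esub> s)
      = restr \<O> V W r \<odot>\<^bsub>sections (E i q) W\<^esub> restr (E i q) V W s"
  by (rule sheaf_of_modules.restr_smult[OF E_sheaf[OF i]]) (use i V W VU WV in \<open>auto simp: openin_U\<close>)

lemma E_restr_signed:
  "s \<in> carrier (sections (E i q) V) \<Longrightarrow>
    restr (E i q) V W (signed (sections (E i q) V) k s)
      = signed (sections (E i q) W) k (restr (E i q) V W s)"
  using W VU WV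
  by (intro additive_signed[of "sections (E i q) V" "sections (E i q) W" "restr (E i q) V W"]
      E_group i V W E_restr_closed E_restr_add) auto

end

section \<open>The components of \<open>a\<close> as linear maps of sections compatible with
  restriction\<close>

lemma a_sheaf_hom:
  assumes "xs \<in> tuples I" "q = m + 1 - int (sdeg xs)"
  shows "sheaf_hom (subtopology X (inters U xs)) \<O> (E (last xs) m) (E (hd xs) q) (a xs m)"
proof -
  have "a \<in> hom_cochains X \<O> I U (sdeg xs) (1 - int (sdeg xs)) E E"
    using twisted_complex by (auto simp: generalized_twisted_complex_def)
  moreover have "set xs \<subseteq> I" "length xs = Suc (sdeg xs)"
    using assms by (auto simp: tuples_def length_tuple)
  moreover have "q = m + (1 - int (sdeg xs))" using assms by simp
  ultimately show ?thesis unfolding hom_cochains_def by blast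
qed

context
  fixes xs q m i l W
  assumes xs: "xs \<in> tuples I" and q: "q = m + 1 - int (sdeg xs)"
    and l: "last xs = l" and i: "hd xs = i"
    and W: "openin X W" "W \<subseteq> inters U xs"
begin

lemma openin_W: "openin (subtopology X (inters U xs)) T \<longleftrightarrow> openin X T \<and> T \<subseteq> inters U xs"
  using openin_inters[OF xs] openin_open_subtopology by blast

text \<open>The target degree \<open>q\<close> and the end indices \<open>l\<close> and
  \<open>i\<close> are variables tied to \<open>xs\<close> by equations, so that the facts below fit
  tuples such as \<open>take (Suc k) xs\<close> and \<open>xs @ [j]\<close>, whose degrees and ends
  appear in several equal forms.\<close>

lemma a_hom: "sheaf_hom (subtopology X (inters U xs)) \<O> (E l m) (E i q) (a xs m)"
  using a_sheaf_hom[OF xs q] l i by simp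

lemma a_closed: "s \<in> carrier (sections (E l m) W) \<Longrightarrow> a xs m W s \<in> carrier (sections (E i q) W)"
  by (rule sheaf_homD(1)[OF a_hom]) (use W in \<open>auto simp: openin_W\<close>)

lemma a_add:
  "\<lbrakk>s \<in> carrier (sections (E l m) W); t \<in> carrier (sections (E l m) W)\<rbrakk> \<Longrightarrow>
    a xs m W (s \<oplus>\<^bsub>sections (E l m) W\<^esub> t) = a xs m W s \<oplus>\<^bsub>sections (E i q) W\<^esub> a xs m W t"
  by (rule sheaf_homD(2)[OF a_hom]) (use W in \<open>auto simp: openin_W\<close>)

lemma a_smult:
  "\<lbrakk>r \<in> carrier (sections \<O> W); s \<in> carrier (sections (E l m) W)\<rbrakk> \<Longrightarrow>
    a xs m W (r \<odot>\<^bsub>sections (E l m) W\<^esub> s) = r \<odot>\<^bsub>sections (E i q) W\<^esub> a xs m W s"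
  by (rule sheaf_homD(3)[OF a_hom]) (use W in \<open>auto simp: openin_W\<close>)

lemma a_restr:
  "\<lbrakk>openin X T; T \<subseteq> W; s \<in> carrier (sections (E l m) W)\<rbrakk> \<Longrightarrow>
    restr (E i q) W T (a xs m W s) = a xs m T (restr (E l m) W T s)"
  by (rule sheaf_homD(4)[OF a_hom]) (use W in \<open>auto simp: openin_W\<close>)

text \<open>Both end indices occur in \<open>xs\<close>, so \<open>W\<close> lies in
  \<open>U l\<close> and in \<open>U i\<close>.\<close>

lemma a_groups: "abelian_group (sections (E l m) W)" "abelian_group (sections (E i q) W)"
proof -
  have "xs \<noteq> []" "set xs \<subseteq> I" using xs by (auto simp: tuples_def)
  then have "l \<in> set xs" "i \<in> set xs" using l i by auto
  then have "l \<in> I" "i \<in> I" "W \<subseteq> U l" "W \<subseteq> U i"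
    using W \<open>set xs \<subseteq> I\<close> by (auto simp: inters_def)
  then show "abelian_group (sections (E l m) W)" "abelian_group (sections (E i q) W)"
    by (simp_all add: E_group W(1))
qed

lemma a_signed:
  "s \<in> carrier (sections (E l m) W) \<Longrightarrow>
    a xs m W (signed (sections (E l m) W) k s) = signed (sections (E i q) W) k (a xs m W s)"
  by (intro additive_signed[of "sections (E l m) W" "sections (E i q) W" "a xs m W"]
      a_groups a_closed a_add)

lemma a_zero: "a xs m W \<zero>\<^bsub>sections (E l m) W\<^esub> = \<zero>\<^bsub>sections (E i q) W\<^esub>"
  by (intro additive_zero[of "sections (E l m) W" "sections (E i q) W" "a xs m W"]
      a_groups a_closed a_add)

end

section \<open>The group of cochains over an open set, computed component by component\<close>

lemma comp_module_module:
  assumes "xs \<in> tuples I" "openin X V"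
  shows "module (sections \<O> (inters U xs \<inter> V)) (comp_module U E n V xs)"
  unfolding comp_module_def using assms inters_hd[of xs]
  by (intro E_module hd_in openin_inters_Int) auto

lemma comp_module_group:
  "\<lbrakk>xs \<in> tuples I; openin X V\<rbrakk> \<Longrightarrow> abelian_group (comp_module U E n V xs)"
  using comp_module_module by (rule module.axioms(2))

lemma assoc_sheaf_simps:
  "carrier (sections (assoc_sheaf \<O> I U E n) V)
    = (\<Pi>\<^sub>E xs\<in>tuples I. carrier (comp_module U E n V xs))"
  "\<zero>\<^bsub>sections (assoc_sheaf \<O> I U E n) V\<^esub> = (\<lambda>xs\<in>tuples I. \<zero>\<^bsub>comp_module U E n V xs\<^esub>)"
  "b \<oplus>\<^bsub>sections (assoc_sheaf \<O> I U E n) V\<^esub> c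
    = (\<lambda>xs\<in>tuples I. b xs \<oplus>\<^bsub>comp_module U E n V xs\<^esub> c xs)"
  "r \<odot>\<^bsub>sections (assoc_sheaf \<O> I U E n) V\<^esub> c
    = (\<lambda>xs\<in>tuples I. restr \<O> V (inters U xs \<inter> V) r \<odot>\<^bsub>comp_module U E n V xs\<^esub> c xs)"
  "restr (assoc_sheaf \<O> I U E n) V W c
    = (\<lambda>xs\<in>tuples I.
        restr (E (hd xs) (n - int (sdeg xs))) (inters U xs \<inter> V) (inters U xs \<inter> W) (c xs))"
  by (simp_all add: assoc_sheaf_def)

lemma cochain_component:
  "\<lbrakk>c \<in> carrier (sections (assoc_sheaf \<O> I U E n) V); xs \<in> tuples I\<rbrakk>
    \<Longrightarrow> c xs \<in> carrier (comp_module U E n V xs)"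
  by (auto simp: assoc_sheaf_simps)

text \<open>A product of abelian groups with componentwise operations. The group axioms matter
  because the subtraction in \<open>chain_homotopic\<close> is formed with inverses in this
  product.\<close>

lemma assoc_sheaf_group:
  assumes V: "openin X V"
  shows "abelian_group (sections (assoc_sheaf \<O> I U E n) V)"
proof (rule abelian_groupI)
  note abelian = comp_module_group[OF _ V, THEN abelian_group.axioms(1)]
  note closed = abelian_monoid.a_closed[OF abelian]
  note zero = abelian_monoid.zero_closed[OF abelian]
  show "\<zero>\<^bsub>sections (assoc_sheaf \<O> I U E n) V\<^esub> \<in> carrier (sections (assoc_sheaf \<O> I U E n) V)"
    by (auto simp: assoc_sheaf_simps intro: zero)
  fix x y z
  assume x: "x \<in> carrier (sections (assoc_sheaf \<O> I U E n) V)"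
    and y: "y \<in> carrier (sections (assoc_sheaf \<O> I U E n) V)"
  show "x \<oplus>\<^bsub>sections (assoc_sheaf \<O> I U E n) V\<^esub> y \<in> carrier (sections (assoc_sheaf \<O> I U E n) V)"
    using x y by (auto simp: assoc_sheaf_simps intro!: closed)
  show "x \<oplus>\<^bsub>sections (assoc_sheaf \<O> I U E n) V\<^esub> y = y \<oplus>\<^bsub>sections (assoc_sheaf \<O> I U E n) V\<^esub> x"
    using x y by (auto simp: assoc_sheaf_simps intro!: ext abelian_monoid.a_comm[OF abelian])
  show "\<zero>\<^bsub>sections (assoc_sheaf \<O> I U E n) V\<^esub> \<oplus>\<^bsub>sections (assoc_sheaf \<O> I U E n) V\<^esub> x = x"
  proof (rule ext)
    fix xs
    show "(\<zero>\<^bsub>sections (assoc_sheaf \<O> I U E n) V\<^esub> \<oplus>\<^bsub>sections (assoc_sheaf \<O> I U E n) V\<^esub> x) xs = x xs"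
      using x abelian_monoid.l_zero[OF abelian cochain_component[OF x]]
      by (cases "xs \<in> tuples I") (auto simp: assoc_sheaf_simps)
  qed
  show "\<exists>y\<in>carrier (sections (assoc_sheaf \<O> I U E n) V).
      y \<oplus>\<^bsub>sections (assoc_sheaf \<O> I U E n) V\<^esub> x = \<zero>\<^bsub>sections (assoc_sheaf \<O> I U E n) V\<^esub>"
    using x
    by (intro bexI[of _ "\<lambda>xs\<in>tuples I. \<ominus>\<^bsub>comp_module U E n V xs\<^esub> x xs"])
      (auto simp: assoc_sheaf_simps intro!: ext abelian_group.l_neg[OF comp_module_group] V
        abelian_group.a_inv_closed[OF comp_module_group])
  assume z: "z \<in> carrier (sections (assoc_sheaf \<O> I U E n) V)"
  show "x \<oplus>\<^bsub>sections (assoc_sheaf \<O> I U E n) V\<^esub> y \<oplus>\<^bsub>sections (assoc_sheaf \<O> I U E n) V\<^esub> z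
      = x \<oplus>\<^bsub>sections (assoc_sheaf \<O> I U E n) V\<^esub> (y \<oplus>\<^bsub>sections (assoc_sheaf \<O> I U E n) V\<^esub> z)"
    using x y z by (auto simp: assoc_sheaf_simps intro!: ext abelian_monoid.a_assoc[OF abelian])
qed

text \<open>The record specifies zero and addition but no inverse, so the componentwise inverse is
  identified by uniqueness of inverses in the product group.\<close>

lemma assoc_sheaf_minus:
  assumes V: "openin X V"
    and b: "b \<in> carrier (sections (assoc_sheaf \<O> I U E n) V)"
    and c: "c \<in> carrier (sections (assoc_sheaf \<O> I U E n) V)"
  shows "b \<ominus>\<^bsub>sections (assoc_sheaf \<O> I U E n) V\<^esub> c
    = (\<lambda>xs\<in>tuples I. b xs \<ominus>\<^bsub>comp_module U E n V xs\<^esub> c xs)"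
proof -
  let ?d = "\<lambda>xs\<in>tuples I. \<ominus>\<^bsub>comp_module U E n V xs\<^esub> c xs"
  have "\<ominus>\<^bsub>sections (assoc_sheaf \<O> I U E n) V\<^esub> c = ?d"
    using c by (intro abelian_group.minus_equality[OF assoc_sheaf_group[OF V]])
      (auto simp: assoc_sheaf_simps intro!: ext abelian_group.l_neg[OF comp_module_group] V
        abelian_group.a_inv_closed[OF comp_module_group])
  then show ?thesis
    by (auto simp: a_minus_def assoc_sheaf_simps)
qed

text \<open>Inside \<open>U j\<close> the extra index leaves the intersection with \<open>V\<close>
  unchanged and raises the simplicial degree by one, so the internal degree drops by one. Hence
  appending \<open>j\<close> trades total degree \<open>n\<close> for \<open>n - 1\<close> without
  changing the module.\<close>

lemma comp_module_snoc:
  "\<lbrakk>xs \<in> tuples I; V \<subseteq> U j\<rbrakk> \<Longrightarrow> comp_module U E n V (xs @ [j]) = comp_module U E (n - 1) V xs"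
  by (simp add: comp_module_def inters_simps tuples_def sdeg_snoc Int_absorb1 Int_assoc algebra_simps)

lemma comp_module_omit:
  assumes "xs \<in> tuples I" "k \<in> {1..sdeg xs}"
  shows "comp_module U E n V (omit k xs)
    = sections (E (hd xs) (n + 1 - int (sdeg xs))) (inters U (omit k xs) \<inter> V)"
  using assms by (simp add: comp_module_def hd_omit sdeg_omit tuples_def algebra_simps)

lemma comp_module_drop:
  assumes "xs \<in> tuples I" "k \<le> sdeg xs"
  shows "comp_module U E n V (drop k xs)
    = sections (E (xs ! k) (n - (int (sdeg xs) - int k))) (inters U (drop k xs) \<inter> V)"
  using assms by (simp add: comp_module_def hd_drop sdeg_drop tuples_def)

section \<open>The summands of the differential at a tuple\<close>

definition face where
  "face n V c xs k = signed (comp_module U E (n + 1) V xs) (int k)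
    (restr (E (hd xs) (n + 1 - int (sdeg xs)))
      (inters U (omit k xs) \<inter> V) (inters U xs \<inter> V) (c (omit k xs)))"

text \<open>The degrees use integer subtraction, whereas \<open>assoc_diff\<close> converts the
  natural number \<open>sdeg xs - k\<close>. The two agree for \<open>k \<le> sdeg xs\<close>, and
  the integer form lends itself to sign arithmetic.\<close>

definition act where
  "act n V c xs k = signed (comp_module U E (n + 1) V xs) ((1 - int k) * (int (sdeg xs) - int k))
    (a (take (Suc k) xs) (n - (int (sdeg xs) - int k)) (inters U xs \<inter> V)
      (restr (E (xs ! k) (n - (int (sdeg xs) - int k)))
        (inters U (drop k xs) \<inter> V) (inters U xs \<inter> V) (c (drop k xs))))"

context
  fixes n :: int and V xs
  assumes V: "openin X V" and xs: "xs \<in> tuples I"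
begin

lemma restr_omit_closed:
  assumes c: "c (omit k xs) \<in> carrier (comp_module U E n V (omit k xs))" and k: "k \<in> {1..sdeg xs}"
  shows "restr (E (hd xs) (n + 1 - int (sdeg xs)))
      (inters U (omit k xs) \<inter> V) (inters U xs \<inter> V) (c (omit k xs))
    \<in> carrier (comp_module U E (n + 1) V xs)"
proof -
  have omit: "omit k xs \<in> tuples I" using k xs by (simp add: tuples_omit)
  have hd: "hd (omit k xs) = hd xs" using k xs by (simp add: hd_omit tuples_def)
  have "inters U (omit k xs) \<inter> V \<subseteq> U (hd xs)"
    using inters_hd[OF omit] hd by auto
  moreover have "inters U xs \<inter> V \<subseteq> inters U (omit k xs) \<inter> V"
    using inters_mono[OF set_omit[of k xs], of U] by auto
  moreover have "c (omit k xs) \<in> carrier (sections (E (hd xs) (n + 1 - int (sdeg xs)))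
      (inters U (omit k xs) \<inter> V))"
    using c k xs by (simp add: comp_module_omit)
  ultimately show ?thesis
    unfolding comp_module_def
    by (intro E_restr_closed hd_in xs openin_inters_Int omit V)
qed

lemma face_closed:
  "\<lbrakk>c \<in> carrier (sections (assoc_sheaf \<O> I U E n) V); k \<in> {1..sdeg xs}\<rbrakk>
    \<Longrightarrow> face n V c xs k \<in> carrier (comp_module U E (n + 1) V xs)"
  unfolding face_def
  by (intro signed_closed comp_module_group xs V restr_omit_closed cochain_component tuples_omit)
    simp_all

text \<open>A product term cuts the tuple at position \<open>k\<close>: \<open>a\<close> takes the
  front \<open>take (Suc k) xs\<close>, the cochain takes the back \<open>drop k xs\<close>, and the
  two share the index \<open>xs ! k\<close>, which names the sheaf through which the term
  factors.\<close>

lemma drop_facts: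
  assumes "k \<le> sdeg xs"
  shows "drop k xs \<in> tuples I" "inters U (drop k xs) \<inter> V \<subseteq> U (xs ! k)"
    "inters U xs \<inter> V \<subseteq> inters U (drop k xs) \<inter> V"
    "openin X (inters U (drop k xs) \<inter> V)" "openin X (inters U xs \<inter> V)"
    "take (Suc k) xs \<in> tuples I" "last (take (Suc k) xs) = xs ! k" "hd (take (Suc k) xs) = hd xs"
    "inters U xs \<inter> V \<subseteq> inters U (take (Suc k) xs)"
proof -
  have ne: "xs \<noteq> []" using xs by (simp add: tuples_def)
  show drop: "drop k xs \<in> tuples I" by (rule tuples_drop[OF xs assms])
  show "inters U (drop k xs) \<inter> V \<subseteq> U (xs ! k)"
    using inters_hd[OF drop] hd_drop[OF ne assms] by auto
  show "inters U xs \<inter> V \<subseteq> inters U (drop k xs) \<inter> V"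
    using inters_mono[OF set_drop_subset[of k xs], of U] by auto
  show "openin X (inters U (drop k xs) \<inter> V)" "openin X (inters U xs \<inter> V)"
    by (intro openin_inters_Int drop xs V)+
  show "take (Suc k) xs \<in> tuples I" by (rule tuples_take[OF xs])
  show "last (take (Suc k) xs) = xs ! k" by (rule last_take[OF ne assms])
  show "hd (take (Suc k) xs) = hd xs" by simp
  show "inters U xs \<inter> V \<subseteq> inters U (take (Suc k) xs)"
    using inters_mono[OF set_take_subset[of "Suc k" xs], of U] by auto
qed

lemma restr_drop_closed:
  assumes c: "c (drop k xs) \<in> carrier (comp_module U E n V (drop k xs))" and k: "k \<le> sdeg xs"
  shows "restr (E (xs ! k) (n - (int (sdeg xs) - int k)))
      (inters U (drop k xs) \<inter> V) (inters U xs \<inter> V) (c (drop k xs))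
    \<in> carrier (sections (E (xs ! k) (n - (int (sdeg xs) - int k))) (inters U xs \<inter> V))"
  using c unfolding comp_module_drop[OF xs k]
  by (intro E_restr_closed nth_in[OF xs k] drop_facts[OF k])

text \<open>With \<open>p = sdeg xs\<close>, the degree \<open>n - (p - k)\<close> of the argument
  and the degree \<open>1 - k\<close> of \<open>a\<close> add up to \<open>n + 1 - p\<close>. This
  does not depend on \<open>k\<close>, so all summands lie in one module.\<close>

lemma a_take_closed:
  assumes k: "k \<le> sdeg xs"
    and s: "s \<in> carrier (sections (E (xs ! k) (n - (int (sdeg xs) - int k))) (inters U xs \<inter> V))"
  shows "a (take (Suc k) xs) (n - (int (sdeg xs) - int k)) (inters U xs \<inter> V) s
    \<in> carrier (comp_module U E (n + 1) V xs)"
  unfolding comp_module_def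
  by (rule a_closed[OF drop_facts(6)[OF k] _ drop_facts(7)[OF k] drop_facts(8)[OF k]
        drop_facts(5)[OF k] drop_facts(9)[OF k] s]) (simp add: sdeg_take[OF k])

lemma act_closed:
  "\<lbrakk>c \<in> carrier (sections (assoc_sheaf \<O> I U E n) V); k \<le> sdeg xs\<rbrakk>
    \<Longrightarrow> act n V c xs k \<in> carrier (comp_module U E (n + 1) V xs)"
  unfolding act_def
  by (intro signed_closed comp_module_group xs V a_take_closed restr_drop_closed cochain_component tuples_drop)

lemma cochain_act_eq:
  assumes k: "k \<le> sdeg xs"
  shows "cochain_act U E k (1 - int k) (sdeg xs - k) (n - int (sdeg xs - k)) V a c xs = act n V c xs k"
proof -
  have deg: "int (sdeg xs - k) = int (sdeg xs) - int k"
    "n - (int (sdeg xs) - int k) + (1 - int k) = n + 1 - int (sdeg xs)"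
    using k by simp_all
  show ?thesis
    unfolding cochain_act_def act_def comp_module_def deg ..
qed

lemma assoc_diff_eq:
  assumes c: "c \<in> carrier (sections (assoc_sheaf \<O> I U E n) V)"
  shows "assoc_diff I U E a n V c xs =
    (\<Oplus>\<^bsub>comp_module U E (n + 1) V xs\<^esub> k\<in>{1..sdeg xs}. face n V c xs k)
      \<oplus>\<^bsub>comp_module U E (n + 1) V xs\<^esub>
    (\<Oplus>\<^bsub>comp_module U E (n + 1) V xs\<^esub> k\<in>{..sdeg xs}. act n V c xs k)"
proof -
  interpret M: abelian_group "comp_module U E (n + 1) V xs"
    by (rule comp_module_group[OF xs V])
  have "(\<Oplus>\<^bsub>comp_module U E (n + 1) V xs\<^esub> k\<in>{..sdeg xs}.
      cochain_act U E k (1 - int k) (sdeg xs - k) (n - int (sdeg xs - k)) V a c xs)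
    = (\<Oplus>\<^bsub>comp_module U E (n + 1) V xs\<^esub> k\<in>{..sdeg xs}. act n V c xs k)"
    by (intro M.finsum_cong')
      (auto intro!: act_closed c simp: cochain_act_eq simp del: of_nat_diff)
  then show ?thesis
    using xs by (simp add: assoc_diff_def cochain_delta_def face_def)
qed

end

section \<open>The contraction over a member of the cover\<close>

context
  fixes j V
  assumes j: "j \<in> I" and V: "openin X V" and VU: "V \<subseteq> U j"
begin

text \<open>The map \<open>g\<close> over \<open>V\<close>. With \<open>p = sdeg xs\<close>, the
  component of \<open>a\<close> at \<open>xs @ [j]\<close> has simplicial degree
  \<open>p + 1\<close>, hence internal degree \<open>-p\<close>; it sends degree \<open>n\<close> to
  \<open>n - p\<close>, as total degree \<open>n\<close> requires.\<close>

definition split_in where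
  "split_in n e = (\<lambda>xs\<in>tuples I. signed (comp_module U E n V xs) (int (sdeg xs))
    (a (xs @ [j]) n (inters U xs \<inter> V) (restr (E j n) V (inters U xs \<inter> V) e)))"

text \<open>The homotopy \<open>h\<close> over \<open>V\<close>. Appending \<open>j\<close> at the
  end keeps the head, and the head decides in which sheaf a component lives; prepending
  \<open>j\<close> would move it to \<open>E j\<close>.\<close>

definition contraction where
  "contraction n c = (\<lambda>xs\<in>tuples I.
    signed (comp_module U E (n - 1) V xs) (int (sdeg xs)) (c (xs @ [j])))"

lemma inters_snoc: "inters U (xs @ [j]) \<inter> V = inters U xs \<inter> V"
  using VU by (auto simp: inters_simps)

lemma snoc_component:
  "\<lbrakk>c \<in> carrier (sections (assoc_sheaf \<O> I U E n) V); xs \<in> tuples I\<rbrakk>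
    \<Longrightarrow> c (xs @ [j]) \<in> carrier (comp_module U E (n - 1) V xs)"
  using cochain_component[of c n V "xs @ [j]"] tuples_snoc[OF _ j]
  by (simp add: comp_module_snoc VU)

lemma contraction_closed:
  "c \<in> carrier (sections (assoc_sheaf \<O> I U E n) V)
    \<Longrightarrow> contraction n c \<in> carrier (sections (assoc_sheaf \<O> I U E (n - 1)) V)"
  unfolding contraction_def assoc_sheaf_simps(1)[of "n - 1"]
  by (intro restrict_PiE_iff[THEN iffD2] ballI signed_closed comp_module_group V snoc_component)

lemma restr_j_closed:
  "\<lbrakk>e \<in> carrier (sections (E j n) V); xs \<in> tuples I\<rbrakk>
    \<Longrightarrow> restr (E j n) V (inters U xs \<inter> V) e \<in> carrier (sections (E j n) (inters U xs \<inter> V))"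
  by (intro E_restr_closed j V VU openin_inters_Int) auto

lemma a_snoc_closed:
  assumes xs: "xs \<in> tuples I" and W: "openin X W" "W \<subseteq> inters U xs \<inter> V"
    and s: "s \<in> carrier (sections (E j n) W)"
  shows "a (xs @ [j]) n W s \<in> carrier (sections (E (hd xs) (n - int (sdeg xs))) W)"
proof -
  have "xs \<noteq> []" using xs by (simp add: tuples_def)
  then show ?thesis
    using W VU
    by (intro a_closed[OF tuples_snoc[OF xs j] _ _ _ _ _ s]) (auto simp: sdeg_snoc inters_simps)
qed

lemma split_in_closed:
  "e \<in> carrier (sections (E j n) V) \<Longrightarrow> split_in n e \<in> carrier (sections (assoc_sheaf \<O> I U E n) V)"
  by (auto simp: split_in_def assoc_sheaf_simps(1) comp_module_def
      intro!: signed_closed E_group hd_in V openin_inters_Int a_snoc_closed restr_j_closed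
      dest: inters_hd)

section \<open>The differential at a tuple with \<open>j\<close> appended, and the homotopy
  identity\<close>

context
  fixes n :: int and xs
  assumes xs: "xs \<in> tuples I"
begin

text \<open>Positions \<open>1\<close> to \<open>p = sdeg xs\<close> of \<open>xs @ [j]\<close> lie
  in \<open>xs\<close>, so omitting them commutes with appending \<open>j\<close>. The tuple
  \<open>omit k xs\<close> has simplicial degree \<open>p - 1\<close>, so its contraction carries
  the exponent \<open>p - 1\<close> instead of \<open>p\<close>; this gives the minus sign behind
  the cancellation.\<close>

lemma face_contraction:
  assumes c: "c \<in> carrier (sections (assoc_sheaf \<O> I U E n) V)" and k: "k \<in> {1..sdeg xs}"
  shows "signed (comp_module U E n V xs) (int (sdeg xs)) (face n V c (xs @ [j]) k)
    = signed (comp_module U E n V xs) 1 (face (n - 1) V (contraction n c) xs k)"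
proof -
  let ?M = "comp_module U E n V xs" and ?q = "n - int (sdeg xs)"
  have ne: "xs \<noteq> []" using xs by (simp add: tuples_def)
  have M: "abelian_group ?M" by (rule comp_module_group[OF xs V])
  have omit: "omit k xs \<in> tuples I" using k xs by (simp add: tuples_omit)
  have hd: "hd (omit k xs) = hd xs" using k ne by (simp add: hd_omit)
  have om: "omit k (xs @ [j]) = omit k xs @ [j]" using k ne by (simp add: omit_snoc)
  have mod: "comp_module U E (n - 1) V (omit k xs) = sections (E (hd xs) ?q) (inters U (omit k xs) \<inter> V)"
    using comp_module_omit[OF xs k, of "n - 1"] by simp
  let ?r = "restr (E (hd xs) ?q) (inters U (omit k xs) \<inter> V) (inters U xs \<inter> V)"
  have s: "c (omit k xs @ [j]) \<in> carrier (sections (E (hd xs) ?q) (inters U (omit k xs) \<inter> V))"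
    using snoc_component[OF c omit] mod by simp
  have sub: "inters U (omit k xs) \<inter> V \<subseteq> U (hd xs)" "inters U xs \<inter> V \<subseteq> inters U (omit k xs) \<inter> V"
    using inters_hd[OF omit] hd inters_mono[OF set_omit[of k xs], of U] by auto
  have r: "?r (signed (sections (E (hd xs) ?q) (inters U (omit k xs) \<inter> V)) l (c (omit k xs @ [j])))
      = signed ?M l (?r (c (omit k xs @ [j])))" for l
    unfolding comp_module_def
    by (intro E_restr_signed hd_in xs openin_inters_Int omit V sub s)
  have rs: "?r (c (omit k xs @ [j])) \<in> carrier ?M"
    unfolding comp_module_def
    by (intro E_restr_closed hd_in xs openin_inters_Int omit V sub s)
  have deg: "n + 1 - int (Suc (sdeg xs)) = ?q" "n - 1 + 1 - int (sdeg xs) = ?q" "n - 1 + 1 = n" by simp_all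
  have L: "face n V c (xs @ [j]) k = signed ?M (int k) (?r (c (omit k xs @ [j])))"
    unfolding face_def inters_snoc om hd_snoc[OF ne] sdeg_snoc[OF ne] deg
    by (simp add: comp_module_snoc xs VU)
  have R: "face (n - 1) V (contraction n c) xs k
      = signed ?M (int k + int (sdeg xs - 1)) (?r (c (omit k xs @ [j])))"
    unfolding face_def deg using omit k
    by (simp add: contraction_def mod r signed_signed[OF M rs] sdeg_omit del: of_nat_diff)
  show ?thesis
    unfolding L R signed_signed[OF M rs] by (rule signed_cong) (use k in auto)
qed

text \<open>For \<open>k \<le> p = sdeg xs\<close> the appended \<open>j\<close> stays in the part
  of the tuple handed to \<open>c\<close>. The exponents \<open>p + (1 - k) * (p + 1 - k)\<close> on
  the left and \<open>1 + (1 - k) * (p - k) + (p - k)\<close> on the right are equal.\<close>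

lemma act_contraction:
  assumes c: "c \<in> carrier (sections (assoc_sheaf \<O> I U E n) V)" and k: "k \<le> sdeg xs"
  shows "signed (comp_module U E n V xs) (int (sdeg xs)) (act n V c (xs @ [j]) k)
    = signed (comp_module U E n V xs) 1 (act (n - 1) V (contraction n c) xs k)"
proof -
  let ?M = "comp_module U E n V xs" and ?q = "n - 1 - (int (sdeg xs) - int k)"
    and ?W = "inters U xs \<inter> V" and ?D = "inters U (drop k xs) \<inter> V"
  have ne: "xs \<noteq> []" using xs by (simp add: tuples_def)
  have M: "abelian_group ?M" by (rule comp_module_group[OF xs V])
  note drop = drop_facts[OF V xs k]
  have mod: "comp_module U E (n - 1) V (drop k xs) = sections (E (xs ! k) ?q) ?D"
    by (rule comp_module_drop[OF xs k])
  let ?r = "restr (E (xs ! k) ?q) ?D ?W"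
  let ?a = "a (take (Suc k) xs) ?q ?W"
  have s: "c (drop k xs @ [j]) \<in> carrier (sections (E (xs ! k) ?q) ?D)"
    using snoc_component[OF c drop(1)] mod by simp
  have r: "?r (signed (sections (E (xs ! k) ?q) ?D) l (c (drop k xs @ [j])))
      = signed (sections (E (xs ! k) ?q) ?W) l (?r (c (drop k xs @ [j])))" for l
    by (intro E_restr_signed nth_in[OF xs k] drop s)
  have rs: "?r (c (drop k xs @ [j])) \<in> carrier (sections (E (xs ! k) ?q) ?W)"
    by (intro E_restr_closed nth_in[OF xs k] drop s)
  have as: "?a (?r (c (drop k xs @ [j]))) \<in> carrier ?M"
    using a_take_closed[OF V xs k rs] by simp
  have ar: "?a (signed (sections (E (xs ! k) ?q) ?W) l (?r (c (drop k xs @ [j]))))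
      = signed ?M l (?a (?r (c (drop k xs @ [j]))))" for l
    unfolding comp_module_def
    by (rule a_signed[OF drop(6) _ drop(7,8,5,9) rs]) (simp add: sdeg_take[OF k])
  have deg: "n - (int (Suc (sdeg xs)) - int k) = ?q" "n - 1 + 1 = n" by simp_all
  have L: "act n V c (xs @ [j]) k
      = signed ?M ((1 - int k) * (int (Suc (sdeg xs)) - int k)) (?a (?r (c (drop k xs @ [j]))))"
    unfolding act_def inters_snoc drop_snoc[OF ne k] take_snoc[OF ne k] nth_snoc[OF ne k]
      sdeg_snoc[OF ne] deg
    by (simp add: comp_module_snoc xs VU)
  have R: "act (n - 1) V (contraction n c) xs k
      = signed ?M ((1 - int k) * (int (sdeg xs) - int k) + int (sdeg xs - k)) (?a (?r (c (drop k xs @ [j]))))"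
    unfolding act_def deg using drop(1)
    by (simp add: contraction_def mod r ar signed_signed[OF M as] sdeg_drop del: of_nat_diff)
  show ?thesis
    unfolding L R signed_signed[OF M as] by (rule signed_cong) (use k in auto)
qed

text \<open>Omitting position \<open>p + 1\<close> restores \<open>xs\<close>. Its exponent
  \<open>p + 1\<close> and the exponent \<open>p\<close> of the contraction add up to an odd number,
  which leaves a minus sign.\<close>

lemma face_snoc_last:
  assumes c: "c \<in> carrier (sections (assoc_sheaf \<O> I U E n) V)"
  shows "signed (comp_module U E n V xs) (int (sdeg xs)) (face n V c (xs @ [j]) (Suc (sdeg xs)))
    = signed (comp_module U E n V xs) 1 (c xs)"
proof -
  let ?M = "comp_module U E n V xs"
  have ne: "xs \<noteq> []" using xs by (simp add: tuples_def)
  have M: "abelian_group ?M" by (rule comp_module_group[OF xs V])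
  have cxs: "c xs \<in> carrier ?M" by (rule cochain_component[OF c xs])
  have deg: "n + 1 - int (Suc (sdeg xs)) = n - int (sdeg xs)" by simp
  have "restr (E (hd xs) (n - int (sdeg xs))) (inters U xs \<inter> V) (inters U xs \<inter> V) (c xs) = c xs"
    using cxs inters_hd[OF xs] unfolding comp_module_def
    by (intro E_restr_id[of _ _ "inters U xs \<inter> V"] hd_in xs openin_inters_Int V) auto
  then have face: "face n V c (xs @ [j]) (Suc (sdeg xs)) = signed ?M (int (Suc (sdeg xs))) (c xs)"
    unfolding face_def inters_snoc omit_last[OF ne] hd_snoc[OF ne] sdeg_snoc[OF ne] deg
    by (simp add: comp_module_snoc xs VU)
  show ?thesis
    unfolding face signed_signed[OF M cxs]
    by (intro signed_cong) simp
qed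

text \<open>Here \<open>a\<close> takes the whole of \<open>xs @ [j]\<close> and the cochain keeps
  only \<open>[j]\<close>, of simplicial degree 0. The sign of the product is therefore trivial, and
  the sign of the contraction is the one in \<open>split_in\<close>.\<close>

lemma act_snoc_last:
  assumes c: "c \<in> carrier (sections (assoc_sheaf \<O> I U E n) V)"
  shows "signed (comp_module U E n V xs) (int (sdeg xs)) (act n V c (xs @ [j]) (Suc (sdeg xs)))
    = split_in n (c [j]) xs"
proof -
  have ne: "xs \<noteq> []" using xs by (simp add: tuples_def)
  have len: "length xs = Suc (sdeg xs)" by (rule length_tuple[OF xs])
  have inters_j: "inters U [j] \<inter> V = V" using VU by (auto simp: inters_simps)
  have "act n V c (xs @ [j]) (Suc (sdeg xs))
      = a (xs @ [j]) n (inters U xs \<inter> V) (restr (E j n) V (inters U xs \<inter> V) (c [j]))"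
    unfolding act_def inters_snoc sdeg_snoc[OF ne]
    by (simp add: signed_def len[symmetric] inters_j)
  then show ?thesis
    using xs by (simp add: split_in_def)
qed

text \<open>Splitting the largest index off both sums at \<open>xs @ [j]\<close> isolates the two
  terms on the left. The remaining terms are the negatives of those in the differential of the
  contraction. The second summand on the right is the contraction of the differential, written
  out.\<close>

lemma contraction_homotopy:
  assumes c: "c \<in> carrier (sections (assoc_sheaf \<O> I U E n) V)"
  shows "split_in n (c [j]) xs \<ominus>\<^bsub>comp_module U E n V xs\<^esub> c xs =
    assoc_diff I U E a (n - 1) V (contraction n c) xs \<oplus>\<^bsub>comp_module U E n V xs\<^esub>
    signed (comp_module U E n V xs) (int (sdeg xs)) (assoc_diff I U E a n V c (xs @ [j]))"
proof -
  let ?M = "comp_module U E n V xs" and ?p = "sdeg xs"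
  have ne: "xs \<noteq> []" using xs by (simp add: tuples_def)
  have M: "abelian_group ?M" by (rule comp_module_group[OF xs V])
  interpret M: abelian_group ?M by (rule M)
  note xj = tuples_snoc[OF xs j]
  \<comment> \<open>Total degree \<open>n + 1\<close> at \<open>xs @ [j]\<close> and total degree
    \<open>n\<close> at \<open>xs\<close> give the same module, so all four sums can be compared in
    \<open>?M\<close>.\<close>
  have Mj: "comp_module U E (n + 1) V (xs @ [j]) = ?M" by (simp add: comp_module_snoc xs VU)
  have sj: "sdeg (xs @ [j]) = Suc ?p" by (rule sdeg_snoc[OF ne])
  note h = contraction_closed[OF c]
  have Fh: "face (n - 1) V (contraction n c) xs k \<in> carrier ?M" if "k \<in> {1..?p}" for k
    using face_closed[OF V xs h that] by simp
  have Ah: "act (n - 1) V (contraction n c) xs k \<in> carrier ?M" if "k \<le> ?p" for k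
    using act_closed[OF V xs h that] by simp
  have F: "face n V c (xs @ [j]) k \<in> carrier ?M" if "k \<in> {1..Suc ?p}" for k
    using face_closed[OF V xj c] that by (simp add: sj Mj)
  have A: "act n V c (xs @ [j]) k \<in> carrier ?M" if "k \<le> Suc ?p" for k
    using act_closed[OF V xj c] that by (simp add: sj Mj)
  let ?F = "\<Oplus>\<^bsub>?M\<^esub> k\<in>{1..?p}. face (n - 1) V (contraction n c) xs k"
  let ?A = "\<Oplus>\<^bsub>?M\<^esub> k\<in>{..?p}. act (n - 1) V (contraction n c) xs k"
  have FA: "?F \<in> carrier ?M" "?A \<in> carrier ?M"
    using Fh Ah by (auto intro!: M.finsum_closed)
  have cx: "c xs \<in> carrier ?M" by (rule cochain_component[OF c xs])
  have g: "split_in n (c [j]) xs \<in> carrier ?M"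
    unfolding act_snoc_last[OF c, symmetric] by (intro signed_closed M A) simp
  have d1: "assoc_diff I U E a (n - 1) V (contraction n c) xs = ?F \<oplus>\<^bsub>?M\<^esub> ?A"
    using assoc_diff_eq[OF V xs h] by simp
  have "signed ?M (int ?p) (\<Oplus>\<^bsub>?M\<^esub> k\<in>{1..Suc ?p}. face n V c (xs @ [j]) k)
      = (\<Oplus>\<^bsub>?M\<^esub> k\<in>{1..Suc ?p}. signed ?M (int ?p) (face n V c (xs @ [j]) k))"
    by (intro signed_finsum M F) auto
  also have "\<dots> = signed ?M (int ?p) (face n V c (xs @ [j]) (Suc ?p)) \<oplus>\<^bsub>?M\<^esub>
      (\<Oplus>\<^bsub>?M\<^esub> k\<in>{1..?p}. signed ?M (int ?p) (face n V c (xs @ [j]) k))"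
  proof -
    have "{1..Suc ?p} = insert (Suc ?p) {1..?p}" by auto
    then show ?thesis
      by (simp only:) (rule M.finsum_insert, auto intro!: signed_closed M F)
  qed
  also have "(\<Oplus>\<^bsub>?M\<^esub> k\<in>{1..?p}. signed ?M (int ?p) (face n V c (xs @ [j]) k))
      = (\<Oplus>\<^bsub>?M\<^esub> k\<in>{1..?p}. signed ?M 1 (face (n - 1) V (contraction n c) xs k))"
    by (intro M.finsum_cong') (auto simp: face_contraction[OF c] intro!: signed_closed M Fh)
  also have "\<dots> = signed ?M 1 ?F"
    by (intro signed_finsum[symmetric] M Fh) auto
  finally have f: "signed ?M (int ?p) (\<Oplus>\<^bsub>?M\<^esub> k\<in>{1..Suc ?p}. face n V c (xs @ [j]) k)
      = \<ominus>\<^bsub>?M\<^esub> c xs \<oplus>\<^bsub>?M\<^esub> \<ominus>\<^bsub>?M\<^esub> ?F"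
    unfolding face_snoc_last[OF c] by (simp add: signed_def)
  have "signed ?M (int ?p) (\<Oplus>\<^bsub>?M\<^esub> k\<in>{..Suc ?p}. act n V c (xs @ [j]) k)
      = (\<Oplus>\<^bsub>?M\<^esub> k\<in>{..Suc ?p}. signed ?M (int ?p) (act n V c (xs @ [j]) k))"
    by (intro signed_finsum M A) auto
  also have "\<dots> = signed ?M (int ?p) (act n V c (xs @ [j]) (Suc ?p)) \<oplus>\<^bsub>?M\<^esub>
      (\<Oplus>\<^bsub>?M\<^esub> k\<in>{..?p}. signed ?M (int ?p) (act n V c (xs @ [j]) k))"
    unfolding atMost_Suc
    by (rule M.finsum_insert) (auto intro!: signed_closed M A)
  also have "(\<Oplus>\<^bsub>?M\<^esub> k\<in>{..?p}. signed ?M (int ?p) (act n V c (xs @ [j]) k))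
      = (\<Oplus>\<^bsub>?M\<^esub> k\<in>{..?p}. signed ?M 1 (act (n - 1) V (contraction n c) xs k))"
    by (intro M.finsum_cong') (auto simp: act_contraction[OF c] intro!: signed_closed M Ah)
  also have "\<dots> = signed ?M 1 ?A"
    by (intro signed_finsum[symmetric] M Ah) auto
  finally have f': "signed ?M (int ?p) (\<Oplus>\<^bsub>?M\<^esub> k\<in>{..Suc ?p}. act n V c (xs @ [j]) k)
      = split_in n (c [j]) xs \<oplus>\<^bsub>?M\<^esub> \<ominus>\<^bsub>?M\<^esub> ?A"
    unfolding act_snoc_last[OF c] by (simp add: signed_def)
  have "signed ?M (int ?p) (assoc_diff I U E a n V c (xs @ [j]))
      = signed ?M (int ?p) (\<Oplus>\<^bsub>?M\<^esub> k\<in>{1..Suc ?p}. face n V c (xs @ [j]) k) \<oplus>\<^bsub>?M\<^esub>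
        signed ?M (int ?p) (\<Oplus>\<^bsub>?M\<^esub> k\<in>{..Suc ?p}. act n V c (xs @ [j]) k)"
    unfolding assoc_diff_eq[OF V xj c] Mj sj
    using F A by (intro signed_add M M.finsum_closed) auto
  then have d2: "signed ?M (int ?p) (assoc_diff I U E a n V c (xs @ [j]))
      = (\<ominus>\<^bsub>?M\<^esub> c xs \<oplus>\<^bsub>?M\<^esub> \<ominus>\<^bsub>?M\<^esub> ?F) \<oplus>\<^bsub>?M\<^esub>
        (split_in n (c [j]) xs \<oplus>\<^bsub>?M\<^esub> \<ominus>\<^bsub>?M\<^esub> ?A)"
    unfolding f f' .
  \<comment> \<open>Cancellation of \<open>P\<close> and \<open>Q\<close> in an abelian group,
    stated for arbitrary elements so that the long sums enter it as single symbols.\<close>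
  have alg: "g \<ominus>\<^bsub>?M\<^esub> y = (P \<oplus>\<^bsub>?M\<^esub> Q) \<oplus>\<^bsub>?M\<^esub>
      ((\<ominus>\<^bsub>?M\<^esub> y \<oplus>\<^bsub>?M\<^esub> \<ominus>\<^bsub>?M\<^esub> P) \<oplus>\<^bsub>?M\<^esub> (g \<oplus>\<^bsub>?M\<^esub> \<ominus>\<^bsub>?M\<^esub> Q))"
    if "g \<in> carrier ?M" "y \<in> carrier ?M" "P \<in> carrier ?M" "Q \<in> carrier ?M" for g y P Q
  proof -
    have "(P \<oplus>\<^bsub>?M\<^esub> Q) \<oplus>\<^bsub>?M\<^esub>
      ((\<ominus>\<^bsub>?M\<^esub> y \<oplus>\<^bsub>?M\<^esub> \<ominus>\<^bsub>?M\<^esub> P) \<oplus>\<^bsub>?M\<^esub> (g \<oplus>\<^bsub>?M\<^esub> \<ominus>\<^bsub>?M\<^esub> Q))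
      = (g \<oplus>\<^bsub>?M\<^esub> \<ominus>\<^bsub>?M\<^esub> y) \<oplus>\<^bsub>?M\<^esub>
        ((P \<oplus>\<^bsub>?M\<^esub> \<ominus>\<^bsub>?M\<^esub> P) \<oplus>\<^bsub>?M\<^esub> (Q \<oplus>\<^bsub>?M\<^esub> \<ominus>\<^bsub>?M\<^esub> Q))"
      using that by (simp only: M.a_ac M.a_closed M.a_inv_closed)
    then show ?thesis using that by (simp add: M.r_neg a_minus_def)
  qed
  show ?thesis
    unfolding d1 d2 by (rule alg[OF g cx FA])
qed

section \<open>The Maurer-Cartan equation at \<open>xs @ [j]\<close> and the differential of
  \<open>split_in\<close>\<close>

context
  fixes e
  assumes e: "e \<in> carrier (sections (E j n) V)"
begin

text \<open>The component of \<open>split_in\<close> at \<open>omit k xs\<close> is formed over the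
  larger set \<open>?O\<close>. Naturality of \<open>a\<close> and transitivity of restriction carry
  it to \<open>?W\<close>, where it takes the shape of a term of the Maurer-Cartan equation.\<close>

lemma face_split_in:
  assumes k: "k \<in> {1..sdeg xs}"
  shows "a (omit k xs @ [j]) n (inters U xs \<inter> V) (restr (E j n) V (inters U xs \<inter> V) e)
      \<in> carrier (comp_module U E (n + 1) V xs)"
    and "face n V (split_in n e) xs k = signed (comp_module U E (n + 1) V xs)
      (int k + int (sdeg xs - 1))
      (a (omit k xs @ [j]) n (inters U xs \<inter> V) (restr (E j n) V (inters U xs \<inter> V) e))"
proof -
  let ?M = "comp_module U E (n + 1) V xs" and ?q = "n + 1 - int (sdeg xs)"
    and ?W = "inters U xs \<inter> V" and ?O = "inters U (omit k xs) \<inter> V"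
  let ?y = "a (omit k xs @ [j]) n ?W (restr (E j n) V ?W e)"
    and ?z = "a (omit k xs @ [j]) n ?O (restr (E j n) V ?O e)"
  have ne: "xs \<noteq> []" using xs by (simp add: tuples_def)
  have M: "abelian_group ?M" by (rule comp_module_group[OF xs V])
  have omit: "omit k xs \<in> tuples I" using k xs by (simp add: tuples_omit)
  have hd: "hd (omit k xs) = hd xs" using k ne by (simp add: hd_omit)
  have mod: "comp_module U E n V (omit k xs) = sections (E (hd xs) ?q) ?O"
    using comp_module_omit[OF xs k] .
  have oO: "openin X ?O" and oW: "openin X ?W" by (intro openin_inters_Int omit xs V)+
  have sub: "?O \<subseteq> U (hd xs)" "?W \<subseteq> ?O"
    using inters_hd[OF omit] hd inters_mono[OF set_omit[of k xs], of U] by auto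
  have q: "n - int (sdeg (omit k xs)) = ?q"
    using k by (simp add: sdeg_omit)
  have z: "?z \<in> carrier (sections (E (hd xs) ?q) ?O)"
    using a_snoc_closed[OF omit oO _ restr_j_closed[OF e omit]] unfolding hd q by simp
  have "restr (E j n) ?O ?W (restr (E j n) V ?O e) = restr (E j n) V ?W e"
    by (rule E_restr_comp[OF j V oO VU _ oW sub(2) e]) simp
  moreover have "restr (E (hd xs) ?q) ?O ?W ?z = a (omit k xs @ [j]) n ?W (restr (E j n) ?O ?W (restr (E j n) V ?O e))"
    using omit k VU
    by (intro a_restr[OF tuples_snoc[OF omit j] _ _ _ oO _ oW sub(2) restr_j_closed[OF e omit]])
      (auto simp: sdeg_snoc sdeg_omit hd hd_snoc tuples_def inters_simps)
  ultimately have ry: "restr (E (hd xs) ?q) ?O ?W ?z = ?y" by simp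
  show y: "?y \<in> carrier ?M"
    unfolding ry[symmetric] comp_module_def
    by (intro E_restr_closed hd_in xs oO oW sub z)
  have rl: "restr (E (hd xs) ?q) ?O ?W (signed (sections (E (hd xs) ?q) ?O) l ?z) = signed ?M l ?y" for l
    unfolding ry[symmetric] comp_module_def
    by (intro E_restr_signed hd_in xs oO oW sub z)
  have "split_in n e (omit k xs) = signed (sections (E (hd xs) ?q) ?O) (int (sdeg xs - 1)) ?z"
    using omit k by (simp add: split_in_def mod sdeg_omit del: of_nat_diff)
  then show "face n V (split_in n e) xs k = signed ?M (int k + int (sdeg xs - 1)) ?y"
    unfolding face_def by (simp only: rl signed_signed[OF M y])
qed

text \<open>As for the faces, naturality moves the inner component from \<open>?D\<close> to
  \<open>?W\<close>. In addition the sign of \<open>split_in\<close> sits inside the outer component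
  of \<open>a\<close> and is pulled out by additivity.\<close>

lemma act_split_in:
  assumes k: "k \<le> sdeg xs"
  shows "a (take (Suc k) xs) (n - (int (sdeg xs) - int k)) (inters U xs \<inter> V)
      (a (drop k xs @ [j]) n (inters U xs \<inter> V) (restr (E j n) V (inters U xs \<inter> V) e))
      \<in> carrier (comp_module U E (n + 1) V xs)"
    and "act n V (split_in n e) xs k = signed (comp_module U E (n + 1) V xs)
      ((1 - int k) * (int (sdeg xs) - int k) + int (sdeg xs - k))
      (a (take (Suc k) xs) (n - (int (sdeg xs) - int k)) (inters U xs \<inter> V)
        (a (drop k xs @ [j]) n (inters U xs \<inter> V) (restr (E j n) V (inters U xs \<inter> V) e)))"
proof -
  let ?M = "comp_module U E (n + 1) V xs" and ?q = "n - (int (sdeg xs) - int k)"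
    and ?W = "inters U xs \<inter> V" and ?D = "inters U (drop k xs) \<inter> V"
  let ?y = "a (drop k xs @ [j]) n ?W (restr (E j n) V ?W e)"
    and ?z = "a (drop k xs @ [j]) n ?D (restr (E j n) V ?D e)"
  have ne: "xs \<noteq> []" using xs by (simp add: tuples_def)
  have M: "abelian_group ?M" by (rule comp_module_group[OF xs V])
  note drop = drop_facts[OF V xs k]
  have hd: "hd (drop k xs) = xs ! k" by (rule hd_drop[OF ne k])
  have mod: "comp_module U E n V (drop k xs) = sections (E (xs ! k) ?q) ?D"
    by (rule comp_module_drop[OF xs k])
  have q: "n - int (sdeg (drop k xs)) = ?q"
    using k by (simp add: sdeg_drop)
  have z: "?z \<in> carrier (sections (E (xs ! k) ?q) ?D)"
    using a_snoc_closed[OF drop(1,4) _ restr_j_closed[OF e drop(1)]] unfolding hd q by simp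
  have "restr (E j n) ?D ?W (restr (E j n) V ?D e) = restr (E j n) V ?W e"
    by (rule E_restr_comp[OF j V drop(4) VU _ drop(5,3) e]) simp
  moreover have "restr (E (xs ! k) ?q) ?D ?W ?z = a (drop k xs @ [j]) n ?W (restr (E j n) ?D ?W (restr (E j n) V ?D e))"
    using drop(1) k VU
    by (intro a_restr[OF tuples_snoc[OF drop(1) j] _ _ _ drop(4) _ drop(5,3) restr_j_closed[OF e drop(1)]])
      (auto simp: sdeg_snoc sdeg_drop hd hd_snoc tuples_def inters_simps)
  ultimately have ry: "restr (E (xs ! k) ?q) ?D ?W ?z = ?y" by simp
  have y: "?y \<in> carrier (sections (E (xs ! k) ?q) ?W)"
    unfolding ry[symmetric] by (intro E_restr_closed nth_in[OF xs k] drop z)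
  show ay: "a (take (Suc k) xs) ?q ?W ?y \<in> carrier ?M"
    by (rule a_take_closed[OF V xs k y])
  have rl: "restr (E (xs ! k) ?q) ?D ?W (signed (sections (E (xs ! k) ?q) ?D) l ?z)
      = signed (sections (E (xs ! k) ?q) ?W) l ?y" for l
    unfolding ry[symmetric] by (intro E_restr_signed nth_in[OF xs k] drop z)
  have al: "a (take (Suc k) xs) ?q ?W (signed (sections (E (xs ! k) ?q) ?W) l ?y)
      = signed ?M l (a (take (Suc k) xs) ?q ?W ?y)" for l
    unfolding comp_module_def
    by (rule a_signed[OF drop(6) _ drop(7,8,5,9) y]) (simp add: sdeg_take[OF k])
  have "split_in n e (drop k xs) = signed (sections (E (xs ! k) ?q) ?D) (int (sdeg xs - k)) ?z"
    using drop(1) by (simp add: split_in_def mod sdeg_drop del: of_nat_diff)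
  then show "act n V (split_in n e) xs k = signed ?M
      ((1 - int k) * (int (sdeg xs) - int k) + int (sdeg xs - k)) (a (take (Suc k) xs) ?q ?W ?y)"
    unfolding act_def by (simp only: rl al signed_signed[OF M ay])
qed

text \<open>Since \<open>hom_delta\<close> omits neither end, at \<open>xs @ [j]\<close> it runs
  over the positions \<open>1\<close> to \<open>sdeg xs\<close>, just as
  \<open>cochain_delta\<close> does at \<open>xs\<close>. In the product sum the last summand is set
  apart: its inner factor is \<open>a [j]\<close>, the differential of \<open>E j\<close>.\<close>

lemma maurer_cartan_snoc:
  "(\<Oplus>\<^bsub>comp_module U E (n + 1) V xs\<^esub> k\<in>{1..sdeg xs}.
      signed (comp_module U E (n + 1) V xs) (int k)
        (a (omit k xs @ [j]) n (inters U xs \<inter> V) (restr (E j n) V (inters U xs \<inter> V) e)))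
    \<oplus>\<^bsub>comp_module U E (n + 1) V xs\<^esub>
    (a (xs @ [j]) (n + 1) (inters U xs \<inter> V)
        (a [j] n (inters U xs \<inter> V) (restr (E j n) V (inters U xs \<inter> V) e))
      \<oplus>\<^bsub>comp_module U E (n + 1) V xs\<^esub>
    (\<Oplus>\<^bsub>comp_module U E (n + 1) V xs\<^esub> k\<in>{..sdeg xs}.
      signed (comp_module U E (n + 1) V xs) ((1 - int k) * (int (Suc (sdeg xs)) - int k))
        (a (take (Suc k) xs) (n - (int (sdeg xs) - int k)) (inters U xs \<inter> V)
          (a (drop k xs @ [j]) n (inters U xs \<inter> V) (restr (E j n) V (inters U xs \<inter> V) e)))))
    = \<zero>\<^bsub>comp_module U E (n + 1) V xs\<^esub>" (is ?eq)
  and a_snoc_differential_closed: "a (xs @ [j]) (n + 1) (inters U xs \<inter> V)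
      (a [j] n (inters U xs \<inter> V) (restr (E j n) V (inters U xs \<inter> V) e))
    \<in> carrier (comp_module U E (n + 1) V xs)" (is ?closed)
proof -
  let ?M = "comp_module U E (n + 1) V xs" and ?p = "sdeg xs" and ?W = "inters U xs \<inter> V"
  let ?e = "restr (E j n) V ?W e"
  have ne: "xs \<noteq> []" using xs by (simp add: tuples_def)
  have M: "abelian_group ?M" by (rule comp_module_group[OF xs V])
  interpret M: abelian_group ?M by (rule M)
  have len: "length xs = Suc ?p" by (rule length_tuple[OF xs])
  have j': "[j] \<in> tuples I" using j by (simp add: tuples_def)
  have W: "openin X ?W" by (intro openin_inters_Int xs V)
  have e': "?e \<in> carrier (sections (E j n) ?W)" by (rule restr_j_closed[OF e xs])
  have aje: "a [j] n ?W ?e \<in> carrier (sections (E j (n + 1)) ?W)"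
    using VU by (intro a_closed[OF j' _ _ _ W _ e']) (auto simp: sdeg_def inters_simps)
  show closed: ?closed
    unfolding comp_module_def by (rule a_snoc_closed[OF xs W _ aje]) simp
  \<comment> \<open>One formula for all \<open>k \<le> Suc ?p\<close>. At \<open>k = Suc ?p\<close>
    the degree \<open>n - (int ?p - int k)\<close> becomes \<open>n + 1\<close>, the degree of
    \<open>a [j] n ?W ?e\<close>, and the exponent vanishes.\<close>
  define T where "T k = signed ?M ((1 - int k) * (int (Suc ?p) - int k))
      (a (take (Suc k) (xs @ [j])) (n - (int ?p - int k)) ?W (a (drop k (xs @ [j])) n ?W ?e))" for k
  have T: "T k = signed ?M ((1 - int k) * (int (Suc ?p) - int k))
      (a (take (Suc k) xs) (n - (int ?p - int k)) ?W (a (drop k xs @ [j]) n ?W ?e))" if "k \<le> ?p" for k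
    unfolding T_def take_snoc[OF ne that] drop_snoc[OF ne that] ..
  have Tlast: "T (Suc ?p) = a (xs @ [j]) (n + 1) ?W (a [j] n ?W ?e)"
    by (simp add: T_def len[symmetric] signed_def)
      (simp add: len)
  have Tc: "T k \<in> carrier ?M" if "k \<le> ?p" for k
    unfolding T[OF that] by (intro signed_closed M act_split_in that)
  have deg: "n + (2 - int (Suc ?p)) = n + 1 - int ?p" by simp
  have mc: "maurer_cartan X I U E a"
    using twisted_complex by (simp add: generalized_twisted_complex_def)
  have "set (xs @ [j]) \<subseteq> I \<and> length (xs @ [j]) = Suc (Suc ?p) \<and> openin X ?W \<and>
      ?W \<subseteq> inters U (xs @ [j]) \<and> ?e \<in> carrier (sections (E (last (xs @ [j])) n) ?W)"
    using xs j VU W e' len by (auto simp: tuples_def inters_simps)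
  then have "hom_delta E (2 - int (Suc ?p)) a (xs @ [j]) n ?W ?e \<oplus>\<^bsub>?M\<^esub>
      (\<Oplus>\<^bsub>?M\<^esub> k\<in>{..Suc ?p}. hom_comp E k (1 - int k) (Suc ?p - k) (1 - int (Suc ?p - k)) a a
        (xs @ [j]) n ?W ?e) = \<zero>\<^bsub>?M\<^esub>"
    using mc[unfolded maurer_cartan_def, THEN spec, THEN spec, THEN spec, THEN spec, THEN spec, THEN mp,
        of "xs @ [j]" "Suc ?p" ?W ?e n]
    unfolding comp_module_def deg hd_snoc[OF ne] by blast
  moreover have "hom_delta E (2 - int (Suc ?p)) a (xs @ [j]) n ?W ?e
      = (\<Oplus>\<^bsub>?M\<^esub> k\<in>{1..?p}. signed ?M (int k) (a (omit k xs @ [j]) n ?W ?e))"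
  proof -
    have "length (xs @ [j]) - 2 = ?p" using len by simp
    then show ?thesis
      unfolding hom_delta_def hd_snoc[OF ne] deg comp_module_def[symmetric]
      by (intro M.finsum_cong')
        (auto simp: omit_snoc[OF ne] intro!: signed_closed M face_split_in)
  qed
  moreover have "(\<Oplus>\<^bsub>?M\<^esub> k\<in>{..Suc ?p}. hom_comp E k (1 - int k) (Suc ?p - k)
      (1 - int (Suc ?p - k)) a a (xs @ [j]) n ?W ?e) = (\<Oplus>\<^bsub>?M\<^esub> k\<in>{..Suc ?p}. T k)"
  proof (rule M.finsum_cong')
    show "T \<in> {..Suc ?p} \<rightarrow> carrier ?M"
      using Tc Tlast closed by (auto simp: le_Suc_eq)
    fix k assume "k \<in> {..Suc ?p}"
    then have d: "int (Suc ?p - k) = int (Suc ?p) - int k"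
        "n - (int ?p - int k) + (1 - int k) = n + 1 - int ?p"
        "n + (1 - (int (Suc ?p) - int k)) = n - (int ?p - int k)"
      by auto
    show "hom_comp E k (1 - int k) (Suc ?p - k) (1 - int (Suc ?p - k)) a a (xs @ [j]) n ?W ?e = T k"
      unfolding hom_comp_def T_def hd_snoc[OF ne] d comp_module_def ..
  qed simp
  moreover have "(\<Oplus>\<^bsub>?M\<^esub> k\<in>{..Suc ?p}. T k) = T (Suc ?p) \<oplus>\<^bsub>?M\<^esub> (\<Oplus>\<^bsub>?M\<^esub> k\<in>{..?p}. T k)"
    unfolding atMost_Suc using Tc Tlast closed by (intro M.finsum_insert) auto
  moreover have "(\<Oplus>\<^bsub>?M\<^esub> k\<in>{..?p}. T k) = (\<Oplus>\<^bsub>?M\<^esub> k\<in>{..?p}.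
      signed ?M ((1 - int k) * (int (Suc ?p) - int k))
      (a (take (Suc k) xs) (n - (int ?p - int k)) ?W (a (drop k xs @ [j]) n ?W ?e)))"
    using Tc T by (intro M.finsum_cong') (auto simp: Pi_def)
  ultimately show ?eq unfolding Tlast by simp
qed

text \<open>With \<open>p = sdeg xs\<close>, each summand on the right is \<open>(-1)^(p+1)\<close>
  times its counterpart in the Maurer-Cartan equation at \<open>xs @ [j]\<close>. That equation
  makes the remaining term \<open>?C\<close> the negative of their sum, and \<open>split_in\<close>
  multiplies \<open>?C\<close> by \<open>(-1)^p\<close>.\<close>

lemma split_in_differential:
  "split_in (n + 1) (a [j] n V e) xs = assoc_diff I U E a n V (split_in n e) xs"
proof -
  let ?M = "comp_module U E (n + 1) V xs" and ?p = "sdeg xs" and ?W = "inters U xs \<inter> V"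
  let ?e = "restr (E j n) V ?W e"
  let ?F = "\<lambda>k. a (omit k xs @ [j]) n ?W ?e"
    and ?A = "\<lambda>k. a (take (Suc k) xs) (n - (int ?p - int k)) ?W (a (drop k xs @ [j]) n ?W ?e)"
    and ?C = "a (xs @ [j]) (n + 1) ?W (a [j] n ?W ?e)"
  have M: "abelian_group ?M" by (rule comp_module_group[OF xs V])
  interpret M: abelian_group ?M by (rule M)
  have j': "[j] \<in> tuples I" using j by (simp add: tuples_def)
  have W: "openin X ?W" by (intro openin_inters_Int xs V)
  have "restr (E j (n + 1)) V ?W (a [j] n V e) = a [j] n ?W ?e"
    using VU by (intro a_restr[OF j' _ _ _ V _ W _ e]) (auto simp: sdeg_def inters_simps)
  then have C: "split_in (n + 1) (a [j] n V e) xs = signed ?M (int ?p) ?C"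
    using xs by (simp add: split_in_def)
  have Cc: "?C \<in> carrier ?M" by (rule a_snoc_differential_closed)
  have Fc: "?F k \<in> carrier ?M" if "k \<in> {1..?p}" for k by (rule face_split_in[OF that])
  have Ac: "?A k \<in> carrier ?M" if "k \<in> {..?p}" for k by (rule act_split_in) (use that in simp)
  let ?SF = "\<Oplus>\<^bsub>?M\<^esub> k\<in>{1..?p}. signed ?M (int k) (?F k)"
    and ?SA = "\<Oplus>\<^bsub>?M\<^esub> k\<in>{..?p}. signed ?M ((1 - int k) * (int (Suc ?p) - int k)) (?A k)"
  have S: "?SF \<in> carrier ?M" "?SA \<in> carrier ?M"
    using Fc Ac by (auto intro!: M.finsum_closed signed_closed M)
  have "(\<Oplus>\<^bsub>?M\<^esub> k\<in>{1..?p}. face n V (split_in n e) xs k)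
      = (\<Oplus>\<^bsub>?M\<^esub> k\<in>{1..?p}. signed ?M (int ?p + 1) (signed ?M (int k) (?F k)))"
  proof (rule M.finsum_cong')
    fix k assume k: "k \<in> {1..?p}"
    \<comment> \<open>The exponents \<open>k + (p - 1)\<close> and \<open>p + 1 + k\<close> differ
      by 2; \<open>k \<ge> 1\<close> forces \<open>p \<ge> 1\<close>, so the natural subtraction
      \<open>p - 1\<close> is not truncated.\<close>
    show "face n V (split_in n e) xs k = signed ?M (int ?p + 1) (signed ?M (int k) (?F k))"
      unfolding face_split_in(2)[OF k] signed_signed[OF M Fc[OF k]]
      by (rule signed_cong) (use k in auto)
  qed (use Fc in \<open>auto intro!: signed_closed M\<close>)
  also have "\<dots> = signed ?M (int ?p + 1) ?SF"
    by (intro signed_finsum[symmetric] M signed_closed Fc) simp_all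
  finally have f: "(\<Oplus>\<^bsub>?M\<^esub> k\<in>{1..?p}. face n V (split_in n e) xs k) = signed ?M (int ?p + 1) ?SF" .
  have "(\<Oplus>\<^bsub>?M\<^esub> k\<in>{..?p}. act n V (split_in n e) xs k)
      = (\<Oplus>\<^bsub>?M\<^esub> k\<in>{..?p}. signed ?M (int ?p + 1)
          (signed ?M ((1 - int k) * (int (Suc ?p) - int k)) (?A k)))"
  proof (rule M.finsum_cong')
    fix k assume k: "k \<in> {..?p}"
    then have k': "k \<le> ?p" by simp
    \<comment> \<open>The exponent \<open>(p + 1) + (1 - k) * (p + 1 - k)\<close> exceeds
      \<open>(1 - k) * (p - k) + (p - k)\<close> by exactly 2.\<close>
    show "act n V (split_in n e) xs k = signed ?M (int ?p + 1)
        (signed ?M ((1 - int k) * (int (Suc ?p) - int k)) (?A k))"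
      unfolding act_split_in(2)[OF k'] signed_signed[OF M Ac[OF k]]
      by (rule signed_cong) (use k' in auto)
  qed (use Ac in \<open>auto intro!: signed_closed M\<close>)
  also have "\<dots> = signed ?M (int ?p + 1) ?SA"
    by (intro signed_finsum[symmetric] M signed_closed Ac) simp_all
  finally have f': "(\<Oplus>\<^bsub>?M\<^esub> k\<in>{..?p}. act n V (split_in n e) xs k) = signed ?M (int ?p + 1) ?SA" .
  have mc: "?SF \<oplus>\<^bsub>?M\<^esub> (?C \<oplus>\<^bsub>?M\<^esub> ?SA) = \<zero>\<^bsub>?M\<^esub>" by (rule maurer_cartan_snoc)
  have "?C \<oplus>\<^bsub>?M\<^esub> (?SF \<oplus>\<^bsub>?M\<^esub> ?SA) = \<zero>\<^bsub>?M\<^esub>"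
    using mc S Cc by (simp add: M.a_lcomm)
  then have "\<ominus>\<^bsub>?M\<^esub> (?SF \<oplus>\<^bsub>?M\<^esub> ?SA) = ?C"
    using S Cc by (intro M.minus_equality) auto
  moreover have SC: "?SF \<oplus>\<^bsub>?M\<^esub> ?SA \<in> carrier ?M" using S by simp
  ultimately have Ceq: "?C = signed ?M 1 (?SF \<oplus>\<^bsub>?M\<^esub> ?SA)" by (simp add: signed_def)
  have "split_in (n + 1) (a [j] n V e) xs = signed ?M (int ?p + 1) (?SF \<oplus>\<^bsub>?M\<^esub> ?SA)"
    by (simp only: C Ceq signed_signed[OF M SC])
  also have "\<dots> = signed ?M (int ?p + 1) ?SF \<oplus>\<^bsub>?M\<^esub> signed ?M (int ?p + 1) ?SA"
    by (rule signed_add[OF M S])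
  also have "\<dots> = assoc_diff I U E a n V (split_in n e) xs"
    by (simp only: assoc_diff_eq[OF V xs split_in_closed[OF e]] f f')
  finally show ?thesis .
qed

end

end

end

section \<open>The splitting\<close>

context
  fixes j
  assumes j: "j \<in> I"
begin

lemma singleton_tuple: "[j] \<in> tuples I"
  using j by (simp add: tuples_def)

lemma singleton_simps:
  assumes "V \<subseteq> U j"
  shows "inters U [j] \<inter> V = V" "comp_module U E n V [j] = sections (E j n) V"
  using assms by (auto simp: inters_simps comp_module_def sdeg_def Int_absorb1)

section \<open>Evaluation at \<open>[j]\<close>, \<open>contraction\<close> and
  \<open>split_in\<close> as maps of sheaves\<close>

lemma eval_sheaf_hom:
  "sheaf_hom (subtopology X (U j)) \<O> (assoc_sheaf \<O> I U E n) (E j n) (\<lambda>V c. c [j])"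
  unfolding sheaf_hom_def openin_U[OF j]
proof (intro conjI allI impI ballI)
  fix V assume V: "openin X V \<and> V \<subseteq> U j"
  then have VU: "V \<subseteq> U j" by simp
  fix c assume c: "c \<in> carrier (sections (assoc_sheaf \<O> I U E n) V)"
  show "c [j] \<in> carrier (sections (E j n) V)"
    using cochain_component[OF c singleton_tuple] by (simp add: singleton_simps VU)
  show "(c \<oplus>\<^bsub>sections (assoc_sheaf \<O> I U E n) V\<^esub> d) [j] = c [j] \<oplus>\<^bsub>sections (E j n) V\<^esub> d [j]" for d
    by (simp add: assoc_sheaf_simps singleton_tuple singleton_simps VU)
  show "(r \<odot>\<^bsub>sections (assoc_sheaf \<O> I U E n) V\<^esub> c) [j] = r \<odot>\<^bsub>sections (E j n) V\<^esub> c [j]"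
    if "r \<in> carrier (sections \<O> V)" for r
    using that V by (simp add: assoc_sheaf_simps singleton_tuple singleton_simps restr_id)
  show "restr (E j n) V W (c [j]) = restr (assoc_sheaf \<O> I U E n) V W c [j]"
    if "openin X W \<and> W \<subseteq> U j" for W
    using that V by (simp add: assoc_sheaf_simps singleton_tuple singleton_simps sdeg_def)
qed

lemma contraction_sheaf_hom:
  "sheaf_hom (subtopology X (U j)) \<O> (assoc_sheaf \<O> I U E n) (assoc_sheaf \<O> I U E (n - 1))
    (\<lambda>V. contraction j V n)"
  unfolding sheaf_hom_def openin_U[OF j]
proof (intro conjI allI impI ballI)
  fix V assume V: "openin X V \<and> V \<subseteq> U j"
  then have VU: "V \<subseteq> U j" and oV: "openin X V" by simp_all
  fix c assume c: "c \<in> carrier (sections (assoc_sheaf \<O> I U E n) V)"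
  note snoc = snoc_component[OF j oV VU]
  show "contraction j V n c \<in> carrier (sections (assoc_sheaf \<O> I U E (n - 1)) V)"
    by (rule contraction_closed[OF j oV VU c])
  show "contraction j V n (c \<oplus>\<^bsub>sections (assoc_sheaf \<O> I U E n) V\<^esub> d) =
      contraction j V n c \<oplus>\<^bsub>sections (assoc_sheaf \<O> I U E (n - 1)) V\<^esub> contraction j V n d"
    if d: "d \<in> carrier (sections (assoc_sheaf \<O> I U E n) V)" for d
    unfolding contraction_def[OF j oV VU] assoc_sheaf_simps(3)
    by (rule restrict_ext)
      (simp add: tuples_snoc j comp_module_snoc VU signed_add comp_module_group oV snoc c d)
  show "contraction j V n (r \<odot>\<^bsub>sections (assoc_sheaf \<O> I U E n) V\<^esub> c)
      = r \<odot>\<^bsub>sections (assoc_sheaf \<O> I U E (n - 1)) V\<^esub> contraction j V n c"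
    if r: "r \<in> carrier (sections \<O> V)" for r
    unfolding contraction_def[OF j oV VU] assoc_sheaf_simps(4)
  proof (rule restrict_ext)
    fix xs assume xs: "xs \<in> tuples I"
    have "restr \<O> V (inters U xs \<inter> V) r \<in> carrier (sections \<O> (inters U xs \<inter> V))"
      by (rule restr_closed[OF oV openin_inters_Int[OF xs oV] _ r]) simp
    then show "signed (comp_module U E (n - 1) V xs) (int (sdeg xs))
        ((\<lambda>xs\<in>tuples I. restr \<O> V (inters U xs \<inter> V) r \<odot>\<^bsub>comp_module U E n V xs\<^esub> c xs) (xs @ [j])) =
      restr \<O> V (inters U xs \<inter> V) r \<odot>\<^bsub>comp_module U E (n - 1) V xs\<^esub>
        (\<lambda>xs\<in>tuples I. signed (comp_module U E (n - 1) V xs) (int (sdeg xs)) (c (xs @ [j]))) xs"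
      using xs by (simp add: tuples_snoc j comp_module_snoc VU inters_snoc[OF j oV VU] snoc c
          signed_smult[OF comp_module_module[OF xs oV]])
  qed
  show "restr (assoc_sheaf \<O> I U E (n - 1)) V W (contraction j V n c)
      = contraction j W n (restr (assoc_sheaf \<O> I U E n) V W c)"
    if "openin X W \<and> W \<subseteq> U j" and WV: "W \<subseteq> V" for W
    unfolding contraction_def[OF j oV VU] contraction_def[OF j conjunct1[OF that(1)] conjunct2[OF that(1)]]
      assoc_sheaf_simps(5)
  proof (rule restrict_ext)
    fix xs assume xs: "xs \<in> tuples I"
    then have ne: "xs \<noteq> []" by (simp add: tuples_def)
    have W: "openin X W" "W \<subseteq> U j" using that by simp_all
    let ?q = "n - 1 - int (sdeg xs)"
    have q: "n - int (sdeg (xs @ [j])) = ?q" by (simp add: sdeg_snoc[OF ne])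
    have "restr (E (hd xs) ?q) (inters U xs \<inter> V) (inters U xs \<inter> W)
        (signed (comp_module U E (n - 1) V xs) (int (sdeg xs)) (c (xs @ [j])))
      = signed (comp_module U E (n - 1) W xs) (int (sdeg xs))
        (restr (E (hd xs) ?q) (inters U xs \<inter> V) (inters U xs \<inter> W) (c (xs @ [j])))"
      using snoc[OF c xs] inters_hd[OF xs] WV unfolding comp_module_def
      by (intro E_restr_signed hd_in openin_inters_Int xs oV W(1)) auto
    then show "restr (E (hd xs) ?q) (inters U xs \<inter> V) (inters U xs \<inter> W)
        ((\<lambda>xs\<in>tuples I. signed (comp_module U E (n - 1) V xs) (int (sdeg xs)) (c (xs @ [j]))) xs)
      = signed (comp_module U E (n - 1) W xs) (int (sdeg xs))
        ((\<lambda>xs\<in>tuples I. restr (E (hd xs) (n - int (sdeg xs)))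
          (inters U xs \<inter> V) (inters U xs \<inter> W) (c xs)) (xs @ [j]))"
      using xs by (simp only: restrict_apply' tuples_snoc[OF _ j] q inters_snoc[OF j oV VU]
          inters_snoc[OF j W] hd_snoc[OF ne])
  qed
qed

lemma split_in_sheaf_hom:
  "sheaf_hom (subtopology X (U j)) \<O> (E j n) (assoc_sheaf \<O> I U E n) (\<lambda>V. split_in j V n)"
  unfolding sheaf_hom_def openin_U[OF j]
proof (intro conjI allI impI ballI)
  fix V assume V: "openin X V \<and> V \<subseteq> U j"
  then have VU: "V \<subseteq> U j" and oV: "openin X V" by simp_all
  fix s assume s: "s \<in> carrier (sections (E j n) V)"
  note restr_j = restr_j_closed[OF j oV VU]
  show "split_in j V n s \<in> carrier (sections (assoc_sheaf \<O> I U E n) V)"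
    by (rule split_in_closed[OF j oV VU s])
  \<comment> \<open>Stated for every open \<open>T\<close> inside \<open>U j\<close>, since
    compatibility with restriction needs these facts both over \<open>V\<close> and over a smaller
    set.\<close>
  have sub: "openin X (inters U xs \<inter> T)" "inters U xs \<inter> T \<subseteq> inters U (xs @ [j])"
      "last (xs @ [j]) = j" "hd (xs @ [j]) = hd xs"
      "n - int (sdeg xs) = n + 1 - int (sdeg (xs @ [j]))" "xs @ [j] \<in> tuples I"
    if "xs \<in> tuples I" "openin X T" "T \<subseteq> U j" for xs T
    using that by (auto simp: openin_inters_Int inters_simps sdeg_snoc tuples_def j)
  show "split_in j V n (s \<oplus>\<^bsub>sections (E j n) V\<^esub> t)
      = split_in j V n s \<oplus>\<^bsub>sections (assoc_sheaf \<O> I U E n) V\<^esub> split_in j V n t"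
    if t: "t \<in> carrier (sections (E j n) V)" for t
    unfolding split_in_def[OF j oV VU] assoc_sheaf_simps(3)
  proof (rule restrict_ext)
    fix xs assume xs: "xs \<in> tuples I"
    note sub = sub[OF xs oV VU]
    let ?W = "inters U xs \<inter> V" and ?M = "comp_module U E n V xs"
    let ?a = "\<lambda>e. a (xs @ [j]) n ?W (restr (E j n) V ?W e)"
    have "restr (E j n) V ?W (s \<oplus>\<^bsub>sections (E j n) V\<^esub> t)
        = restr (E j n) V ?W s \<oplus>\<^bsub>sections (E j n) ?W\<^esub> restr (E j n) V ?W t"
      by (intro E_restr_add j oV sub VU s t) simp
    then have "?a (s \<oplus>\<^bsub>sections (E j n) V\<^esub> t) = ?a s \<oplus>\<^bsub>?M\<^esub> ?a t"
      unfolding comp_module_def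
      using a_add[OF sub(6,5,3,4,1,2) restr_j[OF s xs] restr_j[OF t xs]] by simp
    moreover have "?a s \<in> carrier ?M" "?a t \<in> carrier ?M"
      unfolding comp_module_def
      using a_closed[OF sub(6,5,3,4,1,2)] restr_j[OF s xs] restr_j[OF t xs] by simp_all
    ultimately show "signed ?M (int (sdeg xs)) (?a (s \<oplus>\<^bsub>sections (E j n) V\<^esub> t)) =
        (\<lambda>xs\<in>tuples I. signed (comp_module U E n V xs) (int (sdeg xs))
          (a (xs @ [j]) n (inters U xs \<inter> V) (restr (E j n) V (inters U xs \<inter> V) s))) xs \<oplus>\<^bsub>?M\<^esub>
        (\<lambda>xs\<in>tuples I. signed (comp_module U E n V xs) (int (sdeg xs))
          (a (xs @ [j]) n (inters U xs \<inter> V) (restr (E j n) V (inters U xs \<inter> V) t))) xs"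
      using xs by (simp add: signed_add comp_module_group oV)
  qed
  show "split_in j V n (r \<odot>\<^bsub>sections (E j n) V\<^esub> s)
      = r \<odot>\<^bsub>sections (assoc_sheaf \<O> I U E n) V\<^esub> split_in j V n s"
    if r: "r \<in> carrier (sections \<O> V)" for r
    unfolding split_in_def[OF j oV VU] assoc_sheaf_simps(4)
  proof (rule restrict_ext)
    fix xs assume xs: "xs \<in> tuples I"
    note sub = sub[OF xs oV VU]
    let ?W = "inters U xs \<inter> V" and ?M = "comp_module U E n V xs"
    let ?a = "\<lambda>e. a (xs @ [j]) n ?W (restr (E j n) V ?W e)"
    have rW: "restr \<O> V ?W r \<in> carrier (sections \<O> ?W)"
      by (rule restr_closed[OF oV sub(1) _ r]) simp
    have "restr (E j n) V ?W (r \<odot>\<^bsub>sections (E j n) V\<^esub> s)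
        = restr \<O> V ?W r \<odot>\<^bsub>sections (E j n) ?W\<^esub> restr (E j n) V ?W s"
      by (intro E_restr_smult j oV sub VU s r) simp
    then have "?a (r \<odot>\<^bsub>sections (E j n) V\<^esub> s) = restr \<O> V ?W r \<odot>\<^bsub>?M\<^esub> ?a s"
      unfolding comp_module_def
      using a_smult[OF sub(6,5,3,4,1,2) rW restr_j[OF s xs]] by simp
    moreover have "?a s \<in> carrier ?M"
      unfolding comp_module_def by (rule a_closed[OF sub(6,5,3,4,1,2) restr_j[OF s xs]])
    ultimately show "signed ?M (int (sdeg xs)) (?a (r \<odot>\<^bsub>sections (E j n) V\<^esub> s)) =
        restr \<O> V ?W r \<odot>\<^bsub>?M\<^esub> (\<lambda>xs\<in>tuples I. signed (comp_module U E n V xs) (int (sdeg xs))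
          (a (xs @ [j]) n (inters U xs \<inter> V) (restr (E j n) V (inters U xs \<inter> V) s))) xs"
      using xs by (simp add: signed_smult[OF comp_module_module[OF xs oV] rW])
  qed
  show "restr (assoc_sheaf \<O> I U E n) V T (split_in j V n s) = split_in j T n (restr (E j n) V T s)"
    if "openin X T \<and> T \<subseteq> U j" and TV: "T \<subseteq> V" for T
    unfolding split_in_def[OF j oV VU] split_in_def[OF j conjunct1[OF that(1)] conjunct2[OF that(1)]]
      assoc_sheaf_simps(5)
  proof (rule restrict_ext)
    fix xs assume xs: "xs \<in> tuples I"
    have T: "openin X T" "T \<subseteq> U j" using that by simp_all
    note sub = sub[OF xs oV VU] and subT = sub[OF xs T]
    let ?W = "inters U xs \<inter> V" and ?S = "inters U xs \<inter> T" and ?q = "n - int (sdeg xs)"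
    have SW: "?S \<subseteq> ?W" using TV by auto
    have WU: "?W \<subseteq> U (hd xs)" using inters_hd[OF xs] by auto
    let ?y = "a (xs @ [j]) n ?W (restr (E j n) V ?W s)"
    have y: "?y \<in> carrier (sections (E (hd xs) ?q) ?W)"
      by (rule a_closed[OF sub(6,5,3,4,1,2) restr_j[OF s xs]])
    \<comment> \<open>Restricting before or after \<open>split_in\<close> leads to the same
      expression: the component of \<open>a\<close> over \<open>?S\<close>, applied to the
      restriction of \<open>s\<close> from \<open>V\<close> to \<open>?S\<close>.\<close>
    have "restr (E j n) ?W ?S (restr (E j n) V ?W s) = restr (E j n) V ?S s"
      by (rule E_restr_comp[OF j oV sub(1) VU _ subT(1) SW s]) simp
    moreover have "restr (E j n) T ?S (restr (E j n) V T s) = restr (E j n) V ?S s"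
      by (rule E_restr_comp[OF j oV T(1) VU TV subT(1) _ s]) simp
    moreover have "restr (E (hd xs) ?q) ?W ?S ?y = a (xs @ [j]) n ?S (restr (E j n) ?W ?S (restr (E j n) V ?W s))"
      by (rule a_restr[OF sub(6,5,3,4,1,2) subT(1) SW restr_j[OF s xs]])
    moreover have "restr (E (hd xs) ?q) ?W ?S (signed (comp_module U E n V xs) (int (sdeg xs)) ?y)
        = signed (comp_module U E n T xs) (int (sdeg xs)) (restr (E (hd xs) ?q) ?W ?S ?y)"
      unfolding comp_module_def by (rule E_restr_signed[OF hd_in[OF xs] sub(1) subT(1) WU SW y])
    ultimately show "restr (E (hd xs) ?q) ?W ?S
        ((\<lambda>xs\<in>tuples I. signed (comp_module U E n V xs) (int (sdeg xs))
          (a (xs @ [j]) n (inters U xs \<inter> V) (restr (E j n) V (inters U xs \<inter> V) s))) xs)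
      = signed (comp_module U E n T xs) (int (sdeg xs))
        (a (xs @ [j]) n ?S (restr (E j n) T ?S (restr (E j n) V T s)))"
      using xs by simp
  qed
qed

section \<open>The two chain maps\<close>

lemma eval_chain_map:
  "chain_map (subtopology X (U j)) \<O> (assoc_sheaf \<O> I U E) (assoc_diff I U E a) (E j) (a [j])
    (\<lambda>n V c. c [j])"
  unfolding chain_map_def openin_U[OF j]
proof (intro conjI allI impI ballI eval_sheaf_hom)
  fix n V c
  assume V: "openin X V \<and> V \<subseteq> U j" and c: "c \<in> carrier (sections (assoc_sheaf \<O> I U E n) V)"
  have j': "inters U [j] \<inter> V = V" "V \<subseteq> inters U [j]"
    using V by (auto simp: inters_simps)
  have cj: "c [j] \<in> carrier (sections (E j n) V)"
    using cochain_component[OF c singleton_tuple] V by (simp add: singleton_simps)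
  have closed: "a [j] n V (c [j]) \<in> carrier (sections (E j (n + 1)) V)"
    using V j'(2) by (intro a_closed[OF singleton_tuple _ _ _ _ _ cj]) (auto simp: sdeg_def)
  interpret M: abelian_group "sections (E j (n + 1)) V" using E_group[OF j] V by simp
  have "restr (E j n) V V (c [j]) = c [j]"
    using V by (intro E_restr_id[OF j _ _ _ _ cj, of V]) auto
  \<comment> \<open>The tuple \<open>[j]\<close> has simplicial degree 0, so the differential there
    has no face and only the product term \<open>k = 0\<close>, with trivial sign and identity
    restriction.\<close>
  then have "act n V c [j] 0 = a [j] n V (c [j])"
    by (simp add: act_def signed_def sdeg_def j')
  then show "assoc_diff I U E a n V c [j] = a [j] n V (c [j])"
    using assoc_diff_eq[OF _ singleton_tuple c] V closed
    by (simp add: sdeg_def singleton_simps)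
qed

lemma split_in_chain_map:
  "chain_map (subtopology X (U j)) \<O> (E j) (a [j]) (assoc_sheaf \<O> I U E) (assoc_diff I U E a)
    (\<lambda>n V. split_in j V n)"
  unfolding chain_map_def openin_U[OF j]
proof (intro conjI allI impI ballI split_in_sheaf_hom)
  fix n V e
  assume V: "openin X V \<and> V \<subseteq> U j" and e: "e \<in> carrier (sections (E j n) V)"
  show "split_in j V (n + 1) (a [j] n V e) = assoc_diff I U E a n V (split_in j V n e)"
  proof (rule ext)
    fix xs
    show "split_in j V (n + 1) (a [j] n V e) xs = assoc_diff I U E a n V (split_in j V n e) xs"
    proof (cases "xs \<in> tuples I")
      case True
      then show ?thesis using split_in_differential[OF j _ _ _ e] V by blast
    next
      case False
      \<comment> \<open>Outside \<open>tuples I\<close> both sides are extensional functions and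
        take the value \<open>undefined\<close>.\<close>
      have "\<exists>u. split_in j V (n + 1) (a [j] n V e) = restrict u (tuples I)"
        unfolding split_in_def[OF j conjunct1[OF V] conjunct2[OF V]] by blast
      then show ?thesis using False by (auto simp: assoc_diff_def)
    qed
  qed
qed

section \<open>The two homotopies\<close>

lemma split_in_eval:
  assumes V: "openin X V" "V \<subseteq> U j" and e: "e \<in> carrier (sections (E j n) V)"
  shows "split_in j V n e [j] = a [j, j] n V e"
    and "a [j, j] n V e \<in> carrier (sections (E j n) V)"
proof -
  \<comment> \<open>Appending \<open>j\<close> to \<open>[j]\<close> yields the tuple
    \<open>[j, j]\<close>; the sign and the restriction from \<open>V\<close> to itself are trivial,
    so the composite equals the idempotent exactly.\<close>
  show "split_in j V n e [j] = a [j, j] n V e"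
    using singleton_tuple E_restr_id[OF j V(1) V(1) V(2) _ e]
    by (simp add: split_in_def[OF j V] singleton_simps[OF V(2)] signed_def sdeg_def)
  have "split_in j V n e [j] \<in> carrier (sections (E j n) V)"
    using cochain_component[OF split_in_closed[OF j V e] singleton_tuple]
    by (simp add: singleton_simps V)
  then show "a [j, j] n V e \<in> carrier (sections (E j n) V)"
    using \<open>split_in j V n e [j] = a [j, j] n V e\<close> by simp
qed

text \<open>The zero map serves as the homotopy between evaluation after \<open>split_in\<close> and
  \<open>a [j, j]\<close>, which coincide.\<close>

lemma zero_sheaf_hom:
  "sheaf_hom (subtopology X (U j)) \<O> (E j n) (E j m) (\<lambda>V s. \<zero>\<^bsub>sections (E j m) V\<^esub>)"
  unfolding sheaf_hom_def openin_U[OF j]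
proof (intro conjI allI impI ballI)
  fix V s assume V: "openin X V \<and> V \<subseteq> U j"
  interpret module "sections \<O> V" "sections (E j m) V" using E_module[OF j] V by simp
  show "\<zero>\<^bsub>sections (E j m) V\<^esub> \<in> carrier (sections (E j m) V)" by simp
  show "\<zero>\<^bsub>sections (E j m) V\<^esub> = \<zero>\<^bsub>sections (E j m) V\<^esub> \<oplus>\<^bsub>sections (E j m) V\<^esub> \<zero>\<^bsub>sections (E j m) V\<^esub>"
    by simp
  show "\<zero>\<^bsub>sections (E j m) V\<^esub> = r \<odot>\<^bsub>sections (E j m) V\<^esub> \<zero>\<^bsub>sections (E j m) V\<^esub>"
    if "r \<in> carrier (sections \<O> V)" for r
    using that by simp
  show "restr (E j m) V W \<zero>\<^bsub>sections (E j m) V\<^esub> = \<zero>\<^bsub>sections (E j m) W\<^esub>"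
    if "openin X W \<and> W \<subseteq> U j" "W \<subseteq> V" for W
    using V that
    by (intro additive_zero[of "sections (E j m) V" "sections (E j m) W" "restr (E j m) V W"]
        E_group[OF j] E_restr_closed[OF j] E_restr_add[OF j]) auto
qed

lemma eval_split_in_homotopic:
  "chain_homotopic (subtopology X (U j)) \<O> (E j) (a [j]) (E j) (a [j])
    (\<lambda>n V s. split_in j V n s [j]) (a [j, j])"
  unfolding chain_homotopic_def
proof (intro exI[of _ "\<lambda>n V s. \<zero>\<^bsub>sections (E j (n - 1)) V\<^esub>"] conjI allI impI ballI zero_sheaf_hom)
  fix n V e
  assume "openin (subtopology X (U j)) V" and e: "e \<in> carrier (sections (E j n) V)"
  then have V: "openin X V" "V \<subseteq> U j" by (simp_all add: openin_U[OF j])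
  interpret M: abelian_group "sections (E j n) V" by (rule E_group[OF j V])
  have "a [j] (n - 1) V \<zero>\<^bsub>sections (E j (n - 1)) V\<^esub> = \<zero>\<^bsub>sections (E j n) V\<^esub>"
    using V by (intro a_zero[OF singleton_tuple]) (auto simp: sdeg_def inters_simps)
  then show "split_in j V n e [j] \<ominus>\<^bsub>sections (E j n) V\<^esub> a [j, j] n V e =
      a [j] (n - 1) V \<zero>\<^bsub>sections (E j (n - 1)) V\<^esub> \<oplus>\<^bsub>sections (E j n) V\<^esub>
      \<zero>\<^bsub>sections (E j (n + 1 - 1)) V\<^esub>"
    using split_in_eval[OF V e] by (simp add: a_minus_def M.r_neg)
qed

text \<open>The homotopy is \<open>contraction\<close>: \<open>assoc_sheaf_minus\<close> reduces the
  claim to components, where it is \<open>contraction_homotopy\<close>.\<close>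

lemma split_in_eval_homotopic:
  "chain_homotopic (subtopology X (U j)) \<O>
    (assoc_sheaf \<O> I U E) (assoc_diff I U E a) (assoc_sheaf \<O> I U E) (assoc_diff I U E a)
    (\<lambda>n V c. split_in j V n (c [j])) (\<lambda>n V c. c)"
  unfolding chain_homotopic_def
proof (intro exI[of _ "\<lambda>n V. contraction j V n"] conjI allI impI ballI contraction_sheaf_hom)
  fix n V c
  assume "openin (subtopology X (U j)) V" and c: "c \<in> carrier (sections (assoc_sheaf \<O> I U E n) V)"
  then have V: "openin X V" "V \<subseteq> U j" by (simp_all add: openin_U[OF j])
  have cj: "c [j] \<in> carrier (sections (E j n) V)"
    using cochain_component[OF c singleton_tuple] V by (simp add: singleton_simps)
  show "split_in j V n (c [j]) \<ominus>\<^bsub>sections (assoc_sheaf \<O> I U E n) V\<^esub> c =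
      assoc_diff I U E a (n - 1) V (contraction j V n c) \<oplus>\<^bsub>sections (assoc_sheaf \<O> I U E n) V\<^esub>
      contraction j V (n + 1) (assoc_diff I U E a n V c)"
    unfolding assoc_sheaf_minus[OF V(1) split_in_closed[OF j V cj] c] assoc_sheaf_simps(3)
    by (rule restrict_ext) (simp add: contraction_homotopy[OF j V _ c] contraction_def[OF j V])
qed

end

end

theorem proposition16:
  fixes X :: "'a topology"
    and \<O> :: "('a, 'r) ring_presheaf"
    and I :: "'i set"
    and U :: "'i \<Rightarrow> 'a set"
    and E :: "'i \<Rightarrow> ('a, 'r, 'm) graded_sheaf"
    and a :: "('i, 'a, 'm, 'm) bigraded_map"
    and j :: 'i
  assumes "locally_ringed_space X \<O>"
    and "paracompact_space X"
    and "locally_finite_open_cover X I U"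
    and "generalized_twisted_complex X \<O> I U E a"
    and "j \<in> I"
  shows "\<exists>f g.
    chain_map (subtopology X (U j)) \<O>
      (assoc_sheaf \<O> I U E) (assoc_diff I U E a) (E j) (a [j]) f \<and>
    chain_map (subtopology X (U j)) \<O>
      (E j) (a [j]) (assoc_sheaf \<O> I U E) (assoc_diff I U E a) g \<and>
    chain_homotopic (subtopology X (U j)) \<O> (E j) (a [j]) (E j) (a [j])
      (\<lambda>n V s. f n V (g n V s)) (a [j, j]) \<and>
    chain_homotopic (subtopology X (U j)) \<O>
      (assoc_sheaf \<O> I U E) (assoc_diff I U E a) (assoc_sheaf \<O> I U E) (assoc_diff I U E a)
      (\<lambda>n V c. g n V (f n V c)) (\<lambda>n V c. c)"
proof -
  interpret twisted X \<O> I U E a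
    using assms(1,3,4)
    by (intro twisted.intro twisted_axioms.intro)
      (auto simp: locally_ringed_space_def locally_finite_open_cover_def)
  show ?thesis
    by (intro exI[of _ "\<lambda>n V c. c [j]"] exI[of _ "\<lambda>n V. split_in j V n"] conjI eval_chain_map split_in_chain_map eval_split_in_homotopic
        split_in_eval_homotopic assms(5))
qed

end
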